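(* Assume that: (1) problem (P) (defined in the context) is feasible; $\mathcal{U}$ is compact and $\mathcal{X}^s$ is closed; the cost functions $\ell_0,\dots,\ell_N$ are non-negative and continuous; and $\mathcal{Q}$ is weakly continuous, i.e. $(x,u)\mapsto\int_{\mathcal{X}}v(y)\,\mathcal{Q}(dy|x,u)$ belongs to $C_b(\mathcal{X}\times\mathcal{U})$ for every $v\in C_b(\mathcal{X})$; (2) $\mathcal{X}$ is compact, and $\mathcal{Q}$ admits a Lipschitz continuous density $q$, $\mathcal{Q}(dy|x,u)=q(y|x,u)\,dy$, such that for some $h_x>0$, $|q(y|x,u)-q(y|x',u)|\le h_x\|x-x'\|$ for all $y,x,x'\in\mathcal{X}$, $u\in\mathcal{U}$. Let $\pi^{rz}$ be a policy of the gridded MDP $\mathcal{M}^{rz}$ that is feasible for problem (P$^{rz}$), and let $\pi$ be its adaptation to $\mathcal{M}$ (all defined in the context). Then, when applied to the original MDP $\mathcal{M}$, the policy yields at least a safety of $\alpha-Nh_xM_x\overline{\mu}\Delta_x$, i.e. $$\mathbb{P}^{\pi}_{x_0}\big(x_0,\dots,x_N\in\mathcal{X}^s\big)\ \ge\ \alpha-N\,h_x\,M_x\,\overline{\mu}\,\Delta_x .$$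
   Context: Notation: $[N]=\{0,\dots,N\}$; $\mathbb{1}_A$ is an indicator; $\delta_s$ is a Dirac measure; $C_b(S)$ is the space of bounded continuous real functions on $S$; $\|\cdot\|$ is the norm on $\mathbb{R}^n$; $dy$ is Lebesgue measure; $\|f\|_\infty$ is the sup norm. MDP $\mathcal{M}$. $N$ is a finite horizon. The state space $\mathcal{X}\subset\mathbb{R}^n$ and input space $\mathcal{U}$ are Borel subsets of complete separable metric spaces, and $\mathcal{Q}(\cdot|x,u)$ is a stochastic kernel on $\mathcal{X}$ given $\mathcal{X}\times\mathcal{U}$. $\mathcal{X}=\mathcal{X}^s\cup\{x^\dagger\}$ with safe set $\mathcal{X}^s\in\mathcal{B}(\mathcal{X})$ and an unsafe absorbing state $x^\dagger\notin\mathcal{X}^s$, $\mathcal{Q}(\{x^\dagger\}|x^\dagger,u)=1$ for all $u$. Histories: $\mathcal{H}_0=\mathcal{X}$, $\mathcal{H}_k=\mathcal{X}\times\mathcal{U}\times\mathcal{H}_{k-1}$, with elements $h_k=(x_k,u_{k-1},\dots,u_0,x_0)$. Policies $\pi=(\pi_0,\dots,\pi_{N-1})\in\Pi$ are sequences of Borel stochastic kernels $\pi_k(\cdot|h_k)$ on $\mathcal{U}$; $\mathbb{P}^\pi_{x_0},\mathbb{E}^\pi_{x_0}$ are the induced law and expectation on $\mathcal{H}_N$. Costs: $\ell_k:\mathcal{X}\times\mathcal{U}\to[0,\infty)$ for $k\in[N-1]$ and $\ell_N:\mathcal{X}\to[0,\infty)$. $\alpha$ is the required safety level, and $x_0\in\mathcal{X}$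 is a fixed initial state. Problem (P): minimize over $\pi\in\Pi$ and measurable $a:\mathcal{H}_N\to[0,1]$ the value $\mathbb{E}_{x_0}^{\pi}[a(h_N)(\ell_N(x_N)+\sum_{k=0}^{N-1}\ell_k(x_k,u_k))]$ subject to $\mathbb{E}_{x_0}^{\pi}[a(h_N)\prod_{k=0}^N\mathbb{1}_{\mathcal{X}^s}(x_k)]\ge\alpha$. Augmented MDP $\mathcal{M}^z$. $C_{\max}=\sum_{k=0}^N\|\ell_k\|_\infty$, $\mathcal{C}=[0,C_{\max}]$, $\mathcal{Z}=\mathcal{X}\times\mathcal{C}$ with elements $z=(x,c)$, $\mathcal{Z}^s=\mathcal{X}^s\times\mathcal{C}$; $\mathcal{U}_k=\mathcal{U}$ for $k\in[N-1]$, $\mathcal{U}_N=\{0,1\}$; $\mathcal{Q}^z_k(B\times C|z_k,u_k)=\mathcal{Q}(B|x_k,u_k)\delta_{\min(C_{\max},c_k+\ell_k(x_k,u_k))}(C)$ for $k\in[N-1]$, and $\mathcal{Q}^z_N(\{z\}|z,\cdot)=1$. Set $f_N(z_N,u_N)=u_N(c_N+\ell_N(x_N))$ and $g_N(z_N,u_N)=u_N\mathbb{1}_{\mathcal{Z}^s}(z_N)$. Gridding. Take finite disjoint Borel partitions $\mathcal{X}^s=\bigcup_{j=1}^{M_x}\mathcal{X}_j$, $\mathcal{C}=\bigcup_{j=1}^{M_c}\mathcal{C}_j$, $\mathcal{U}=\bigcup_{j=1}^{M_u}\mathcal{U}_{(j)}$ with representative points $x^r_j\in\mathcal{X}_j$,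 $c^r_j\in\mathcal{C}_j$, $u^r_j\in\mathcal{U}_{(j)}$; $\mathcal{X}^r=\{x_j^r\}_j\cup\{x^\dagger\}$, $\mathcal{C}^r=\{c_j^r\}_j$, $\mathcal{U}^r=\{u_j^r\}_j$, $\mathcal{Z}^r=\mathcal{X}^r\times\mathcal{C}^r$. $\mathcal{Z}$ is partitioned into the cells $\mathcal{X}_i\times\mathcal{C}_l$ and $\{x^\dagger\}\times\mathcal{C}_l$, with representatives $(x_i^r,c_l^r)$ and $(x^\dagger,c_l^r)$ respectively. The map $\xi$ sends a state, cost or input to the representative of its cell, with $\xi(x^\dagger)=x^\dagger$; for histories $\xi$ is applied componentwise. Grid size: $\Delta_x=\max_{j}\sup_{x_1,x_2\in\mathcal{X}_j}\|x_1-x_2\|$; $\overline{\mu}=\max_{j}\int_{\mathcal{X}_j}1\,dx$ (maximal Lebesgue measure of the cells $\mathcal{X}_j$). Gridded MDP $\mathcal{M}^{rz}$: state space $\mathcal{Z}^r$, input spaces $\mathcal{U}^r_k=\mathcal{U}^r$ for $k\in[N-1]$ and $\mathcal{U}^r_N=\{0,1\}$, kernels $\mathcal{Q}^{rz}_k(z_i^r|z,u)=\mathcal{Q}^z_k(\mathcal{Z}_i|z,u)$, where $\mathcal{Z}_i$ is the cell of representative $z_i^r$. Its histories $(z_k,u_{k-1},\dots,u_0,z_0)$ form $\mathcal{H}^{rz}_k$. Policies $\pi^{rz}=(\pi_0^{rz},\dots,\pi^{rz}_N)$ are kernels on $\mathcal{U}^r_k$ given $\mathcal{H}^{rz}_k$.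 Problem (P$^{rz}$): with initial state $(\xi(x_0),0)$, minimize $\mathbb{E}^{\pi^{rz}}[f_N(z_N,u_N)]$ over policies of $\mathcal{M}^{rz}$ subject to $\mathbb{E}^{\pi^{rz}}[g_N(z_N,u_N)]\ge\alpha$. Adaptation (execution of $\pi^{rz}$ on $\mathcal{M}$). For $h_k\in\mathcal{H}_k$ with sub-histories $h_0,\dots,h_{k-1}$ define $\zeta:\mathcal{H}_k\to\mathcal{C}^r$ by $\zeta(h_0)=0$ and $\zeta(h_k)=\xi\big(\min(C_{\max},\zeta(h_{k-1})+\ell_{k-1}(\xi(x_{k-1}),\xi(u_{k-1})))\big)$, and $\psi^r:\mathcal{H}_k\to\mathcal{H}_k^{rz}$ by $\psi^r(h_k)=\big((\xi(x_k),\zeta(h_k)),\xi(u_{k-1}),\dots,\xi(u_0),(\xi(x_0),\zeta(h_0))\big)$. The adaptation of $\pi^{rz}$ is $\pi=(\pi_0,\dots,\pi_{N-1})$ with $\pi_k(\cdot|h_k)=\pi_k^{rz}(\cdot|\psi^r(h_k))$, regarded as a measure on $\mathcal{U}$ supported on $\mathcal{U}^r$.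
   Formalization: A Lebesgue density on all of X contradicts Q({x†}|x†,u)=1, so the density is required only on Borel subsets of X^s, the remaining mass being at x†; also 0 is assumed to be in C^r, so that the initial state (ξ(x_0),0) is a state of the gridded MDP. *)

theory Defs
  imports "HOL-Probability.Probability"
begin

section \<open>Controlled processes with history-dependent randomized policies\<close>

text \<open>A history \<open>(x\<^sub>k, u\<^sub>k\<^sub>-\<^sub>1, \<dots>, u\<^sub>0, x\<^sub>0)\<close> is stored as the pair of the state sequence, indexed
  by \<open>{..k}\<close>, and the input sequence, indexed by \<open>{..<k}\<close>; both are \<open>undefined\<close> outside these
  index sets. A stochastic kernel from \<open>M\<close> to \<open>N\<close> is a map measurable from \<open>M\<close> to \<open>prob_algebra N\<close>.\<close>

type_synonym ('s, 'a) hist = "(nat \<Rightarrow> 's) \<times> (nat \<Rightarrow> 'a)"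

definition hist_space :: "'s measure \<Rightarrow> 'a measure \<Rightarrow> nat \<Rightarrow> ('s, 'a) hist measure" where
  "hist_space S A k = (\<Pi>\<^sub>M i\<in>{..k}. S) \<Otimes>\<^sub>M (\<Pi>\<^sub>M i\<in>{..<k}. A)"

text \<open>Policies \<open>(\<pi>\<^sub>0, \<dots>, \<pi>\<^sub>N\<^sub>-\<^sub>1)\<close>; the values \<open>\<pi> k\<close> with \<open>k \<ge> N\<close> are irrelevant.\<close>

definition policies ::
    "'s measure \<Rightarrow> 'a measure \<Rightarrow> nat \<Rightarrow> (nat \<Rightarrow> ('s, 'a) hist \<Rightarrow> 'a measure) set" where
  "policies S A N = {\<pi>. \<forall>k<N. \<pi> k \<in> hist_space S A k \<rightarrow>\<^sub>M prob_algebra A}"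

text \<open>The law of the history \<open>h\<^sub>k\<close> under the (time-dependent) transition kernels \<open>K\<close>, the policy
  \<open>\<pi>\<close> and the initial state \<open>s0\<close>.\<close>

primrec hist_law ::
    "'s measure \<Rightarrow> 'a measure \<Rightarrow> (nat \<Rightarrow> 's \<Rightarrow> 'a \<Rightarrow> 's measure) \<Rightarrow>
      (nat \<Rightarrow> ('s, 'a) hist \<Rightarrow> 'a measure) \<Rightarrow> 's \<Rightarrow> nat \<Rightarrow> ('s, 'a) hist measure" where
  "hist_law S A K \<pi> s0 0 =
     return (hist_space S A 0) (\<lambda>i\<in>{..0}. s0, \<lambda>i\<in>{..<0}. undefined)"
| "hist_law S A K \<pi> s0 (Suc k) =
     hist_law S A K \<pi> s0 k \<bind> (\<lambda>h.
       \<pi> k h \<bind> (\<lambda>u.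
         K k (fst h k) u \<bind> (\<lambda>s.
           return (hist_space S A (Suc k)) ((fst h)(Suc k := s), (snd h)(k := u)))))"


section \<open>The original problem\<close>

record ('x, 'u) mdp =
  horizon :: nat
  states :: "'x set"
  safe :: "'x set"
  xdag :: 'x
  inputs :: "'u set"
  kern :: "'x \<Rightarrow> 'u \<Rightarrow> 'x measure"
  stage_cost :: "nat \<Rightarrow> 'x \<Rightarrow> 'u \<Rightarrow> real"
  term_cost :: "'x \<Rightarrow> real"

definition state_space :: "('x::topological_space, 'u) mdp \<Rightarrow> 'x measure" where
  "state_space M = restrict_space borel (states M)"

definition input_space :: "('x, 'u::topological_space) mdp \<Rightarrow> 'u measure" where
  "input_space M = restrict_space borel (inputs M)"

definition is_mdp :: "('x::polish_space, 'u::polish_space) mdp \<Rightarrow> bool" where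
  "is_mdp M \<longleftrightarrow>
     states M \<in> sets borel \<and> inputs M \<in> sets borel \<and>
     safe M \<in> sets (state_space M) \<and> xdag M \<notin> safe M \<and> states M = safe M \<union> {xdag M} \<and>
     (\<lambda>(x, u). kern M x u) \<in> state_space M \<Otimes>\<^sub>M input_space M \<rightarrow>\<^sub>M prob_algebra (state_space M) \<and>
     (\<forall>u\<in>inputs M. measure (kern M (xdag M) u) {xdag M} = 1) \<and>
     (\<forall>k<horizon M. \<forall>x\<in>states M. \<forall>u\<in>inputs M. 0 \<le> stage_cost M k x u) \<and>
     (\<forall>x\<in>states M. 0 \<le> term_cost M x)"

definition mdp_policies ::
    "('x::topological_space, 'u::topological_space) mdp \<Rightarrow>
      (nat \<Rightarrow> ('x, 'u) hist \<Rightarrow> 'u measure) set" where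
  "mdp_policies M = policies (state_space M) (input_space M) (horizon M)"

definition mdp_law ::
    "('x::topological_space, 'u::topological_space) mdp \<Rightarrow>
      (nat \<Rightarrow> ('x, 'u) hist \<Rightarrow> 'u measure) \<Rightarrow> 'x \<Rightarrow> ('x, 'u) hist measure" where
  "mdp_law M \<pi> x0 =
     hist_law (state_space M) (input_space M) (\<lambda>k. kern M) \<pi> x0 (horizon M)"

definition P_feasible ::
    "('x::topological_space, 'u::topological_space) mdp \<Rightarrow> 'x \<Rightarrow> real \<Rightarrow> bool" where
  "P_feasible M x0 \<alpha> \<longleftrightarrow>
     (\<exists>\<pi>\<in>mdp_policies M.
       \<exists>a\<in>borel_measurable (hist_space (state_space M) (input_space M) (horizon M)).
         (\<forall>h\<in>space (hist_space (state_space M) (input_space M) (horizon M)). a h \<in> {0..1}) \<and>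
         (\<integral>h. a h * (\<Prod>k\<le>horizon M. indicator (safe M) (fst h k)) \<partial>mdp_law M \<pi> x0) \<ge> \<alpha>)"

definition Cb :: "'s::topological_space set \<Rightarrow> ('s \<Rightarrow> real) set" where
  "Cb S = {f. continuous_on S f \<and> bounded (f ` S)}"

definition weakly_continuous ::
    "('x::topological_space, 'u::topological_space) mdp \<Rightarrow> bool" where
  "weakly_continuous M \<longleftrightarrow>
     (\<forall>v\<in>Cb (states M). (\<lambda>(x, u). \<integral>y. v y \<partial>kern M x u) \<in> Cb (states M \<times> inputs M))"

text \<open>Since \<open>Q\<close> has an atom at \<open>x\<^sup>\<dagger>\<close> (at least for \<open>x = x\<^sup>\<dagger>\<close>), the identity
  \<open>Q(dy|x,u) = q(y|x,u) dy\<close> can only be meant on the safe set; the remaining mass of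
  \<open>Q(\<cdot>|x,u)\<close> sits at \<open>x\<^sup>\<dagger>\<close>.\<close>

definition has_density ::
    "('x::euclidean_space, 'u) mdp \<Rightarrow> ('x \<Rightarrow> 'x \<Rightarrow> 'u \<Rightarrow> real) \<Rightarrow> bool" where
  "has_density M q \<longleftrightarrow>
     (\<forall>x\<in>states M. \<forall>u\<in>inputs M.
       (\<lambda>y. q y x u) \<in> borel_measurable (state_space M) \<and>
       (\<forall>y\<in>states M. 0 \<le> q y x u) \<and>
       (\<forall>B\<in>sets borel. B \<subseteq> safe M \<longrightarrow>
          emeasure (kern M x u) B = (\<integral>\<^sup>+y\<in>B. ennreal (q y x u) \<partial>lborel)))"


section \<open>The augmented MDP\<close>

definition sup_norm :: "'s set \<Rightarrow> ('s \<Rightarrow> real) \<Rightarrow> real" where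
  "sup_norm S f = (SUP s\<in>S. \<bar>f s\<bar>)"

definition Cmax :: "('x, 'u) mdp \<Rightarrow> real" where
  "Cmax M = (\<Sum>k<horizon M. sup_norm (states M \<times> inputs M) (\<lambda>(x, u). stage_cost M k x u))
     + sup_norm (states M) (term_cost M)"

definition costs :: "('x, 'u) mdp \<Rightarrow> real set" where
  "costs M = {0..Cmax M}"

definition aug_kern ::
    "('x::topological_space, 'u) mdp \<Rightarrow> nat \<Rightarrow> 'x \<times> real \<Rightarrow> 'u \<Rightarrow> ('x \<times> real) measure" where
  "aug_kern M k z u =
     kern M (fst z) u \<Otimes>\<^sub>M
     return (restrict_space borel (costs M)) (min (Cmax M) (snd z + stage_cost M k (fst z) u))"

definition gN :: "('x, 'u) mdp \<Rightarrow> 'x \<times> real \<Rightarrow> nat \<Rightarrow> real" where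
  "gN M z u = real u * indicator (safe M \<times> costs M) z"


section \<open>Gridding\<close>

text \<open>\<open>is_partition m A r S\<close>: the cells \<open>A 1, \<dots>, A m\<close> form a Borel partition of \<open>S\<close> with
  representatives \<open>r j \<in> A j\<close>.\<close>

definition is_partition ::
    "nat \<Rightarrow> (nat \<Rightarrow> 's::topological_space set) \<Rightarrow> (nat \<Rightarrow> 's) \<Rightarrow> 's set \<Rightarrow> bool" where
  "is_partition m A r S \<longleftrightarrow>
     disjoint_family_on A {1..m} \<and> (\<Union>j\<in>{1..m}. A j) = S \<and>
     (\<forall>j\<in>{1..m}. A j \<in> sets borel \<and> r j \<in> A j)"

definition representative ::
    "nat \<Rightarrow> (nat \<Rightarrow> 's set) \<Rightarrow> (nat \<Rightarrow> 's) \<Rightarrow> 's \<Rightarrow> 's" where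
  "representative m A r s = r (THE j. j \<in> {1..m} \<and> s \<in> A j)"

record ('x, 'u) grid =
  Mx :: nat
  xcell :: "nat \<Rightarrow> 'x set"
  xrep :: "nat \<Rightarrow> 'x"
  Mc :: nat
  ccell :: "nat \<Rightarrow> real set"
  crep :: "nat \<Rightarrow> real"
  Mu :: nat
  ucell :: "nat \<Rightarrow> 'u set"
  urep :: "nat \<Rightarrow> 'u"

text \<open>The cost \<open>0\<close> is a representative, since the gridded MDP starts in \<open>(\<xi>(x\<^sub>0), 0)\<close>.\<close>

definition is_grid :: "('x::topological_space, 'u::topological_space) mdp \<Rightarrow> ('x, 'u) grid \<Rightarrow> bool"
  where
  "is_grid M G \<longleftrightarrow>
     is_partition (Mx G) (xcell G) (xrep G) (safe M) \<and>
     is_partition (Mc G) (ccell G) (crep G) (costs M) \<and>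
     is_partition (Mu G) (ucell G) (urep G) (inputs M) \<and>
     0 \<in> crep G ` {1..Mc G}"

definition xi_x :: "('x, 'u) mdp \<Rightarrow> ('x, 'u) grid \<Rightarrow> 'x \<Rightarrow> 'x" where
  "xi_x M G x = (if x = xdag M then xdag M else representative (Mx G) (xcell G) (xrep G) x)"

definition xi_c :: "('x, 'u) grid \<Rightarrow> real \<Rightarrow> real" where
  "xi_c G = representative (Mc G) (ccell G) (crep G)"

definition xi_u :: "('x, 'u) grid \<Rightarrow> 'u \<Rightarrow> 'u" where
  "xi_u G = representative (Mu G) (ucell G) (urep G)"

definition grid_states :: "('x, 'u) mdp \<Rightarrow> ('x, 'u) grid \<Rightarrow> ('x \<times> real) set" where
  "grid_states M G = (xrep G ` {1..Mx G} \<union> {xdag M}) \<times> crep G ` {1..Mc G}"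

definition grid_inputs :: "('x, 'u) grid \<Rightarrow> 'u set" where
  "grid_inputs G = urep G ` {1..Mu G}"

text \<open>The cell of \<open>Z = X \<times> C\<close> with representative \<open>r\<close>.\<close>

definition zcell :: "('x, 'u) mdp \<Rightarrow> ('x, 'u) grid \<Rightarrow> 'x \<times> real \<Rightarrow> ('x \<times> real) set" where
  "zcell M G r = {(x, c). x \<in> states M \<and> c \<in> costs M \<and> (xi_x M G x, xi_c G c) = r}"

definition grid_size :: "('x::metric_space, 'u) grid \<Rightarrow> real" where
  "grid_size G = Max ((\<lambda>j. diameter (xcell G j)) ` {1..Mx G})"

definition max_cell_measure :: "('x::euclidean_space, 'u) grid \<Rightarrow> real" where
  "max_cell_measure G = Max ((\<lambda>j. measure lborel (xcell G j)) ` {1..Mx G})"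


section \<open>The gridded problem\<close>

definition grid_kern ::
    "('x::topological_space, 'u) mdp \<Rightarrow> ('x, 'u) grid \<Rightarrow>
      nat \<Rightarrow> 'x \<times> real \<Rightarrow> 'u \<Rightarrow> ('x \<times> real) measure" where
  "grid_kern M G k z u =
     point_measure (grid_states M G) (\<lambda>r. emeasure (aug_kern M k z u) (zcell M G r))"

text \<open>A policy of the gridded MDP consists of kernels \<open>\<rho> k\<close>, \<open>k < N\<close>, on the gridded inputs and
  a last kernel \<open>\<rho>N\<close> on \<open>{0, 1}\<close>.\<close>

definition is_grid_policy ::
    "('x, 'u) mdp \<Rightarrow> ('x, 'u) grid \<Rightarrow> (nat \<Rightarrow> ('x \<times> real, 'u) hist \<Rightarrow> 'u measure) \<Rightarrow>
      (('x \<times> real, 'u) hist \<Rightarrow> nat measure) \<Rightarrow> bool" where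
  "is_grid_policy M G \<rho> \<rho>N \<longleftrightarrow>
     \<rho> \<in> policies (count_space (grid_states M G)) (count_space (grid_inputs G)) (horizon M) \<and>
     \<rho>N \<in> hist_space (count_space (grid_states M G)) (count_space (grid_inputs G)) (horizon M)
            \<rightarrow>\<^sub>M prob_algebra (count_space {0, 1})"

text \<open>The joint law of \<open>(h\<^sub>N, u\<^sub>N)\<close>. The final transition is trivial (the state does not move), so
  no state after \<open>u\<^sub>N\<close> is recorded.\<close>

definition grid_law ::
    "('x::topological_space, 'u) mdp \<Rightarrow> ('x, 'u) grid \<Rightarrow>
      (nat \<Rightarrow> ('x \<times> real, 'u) hist \<Rightarrow> 'u measure) \<Rightarrow> (('x \<times> real, 'u) hist \<Rightarrow> nat measure) \<Rightarrow>
      'x \<times> real \<Rightarrow> (('x \<times> real, 'u) hist \<times> nat) measure" where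
  "grid_law M G \<rho> \<rho>N z0 =
     (let S = count_space (grid_states M G); A = count_space (grid_inputs G); N = horizon M in
      hist_law S A (grid_kern M G) \<rho> z0 N \<bind> (\<lambda>h.
        \<rho>N h \<bind> (\<lambda>u. return (hist_space S A N \<Otimes>\<^sub>M count_space {0, 1}) (h, u))))"

definition Prz_feasible ::
    "('x::topological_space, 'u) mdp \<Rightarrow> ('x, 'u) grid \<Rightarrow> 'x \<Rightarrow> real \<Rightarrow>
      (nat \<Rightarrow> ('x \<times> real, 'u) hist \<Rightarrow> 'u measure) \<Rightarrow> (('x \<times> real, 'u) hist \<Rightarrow> nat measure) \<Rightarrow>
      bool" where
  "Prz_feasible M G x0 \<alpha> \<rho> \<rho>N \<longleftrightarrow>
     is_grid_policy M G \<rho> \<rho>N \<and>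
     (\<integral>(h, u). gN M (fst h (horizon M)) u \<partial>grid_law M G \<rho> \<rho>N (xi_x M G x0, 0)) \<ge> \<alpha>"


section \<open>Adaptation of a gridded policy\<close>

text \<open>\<open>zeta M G h k\<close> depends only on the sub-history \<open>h\<^sub>k\<close> of \<open>h\<close>.\<close>

primrec zeta :: "('x, 'u) mdp \<Rightarrow> ('x, 'u) grid \<Rightarrow> ('x, 'u) hist \<Rightarrow> nat \<Rightarrow> real" where
  "zeta M G h 0 = 0"
| "zeta M G h (Suc k) =
     xi_c G (min (Cmax M)
       (zeta M G h k + stage_cost M k (xi_x M G (fst h k)) (xi_u G (snd h k))))"

definition psi ::
    "('x, 'u) mdp \<Rightarrow> ('x, 'u) grid \<Rightarrow> nat \<Rightarrow> ('x, 'u) hist \<Rightarrow> ('x \<times> real, 'u) hist" where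
  "psi M G k h = (\<lambda>i\<in>{..k}. (xi_x M G (fst h i), zeta M G h i), \<lambda>i\<in>{..<k}. xi_u G (snd h i))"

text \<open>The push-forward along the inclusion regards a measure on the gridded inputs as a measure
  on all inputs.\<close>

definition adaptation ::
    "('x, 'u::topological_space) mdp \<Rightarrow> ('x, 'u) grid \<Rightarrow>
      (nat \<Rightarrow> ('x \<times> real, 'u) hist \<Rightarrow> 'u measure) \<Rightarrow> nat \<Rightarrow> ('x, 'u) hist \<Rightarrow> 'u measure" where
  "adaptation M G \<rho> k h = distr (\<rho> k (psi M G k h)) (input_space M) (\<lambda>u. u)"

end

theory Submission
  imports Defs
begin

text \<open>The adapted policy reads a path of the original MDP only through its gridded history \<open>psi\<close>,
  and the gridded history of a path is updated exactly as a history of the gridded MDP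
  (\<open>psi_extend\<close>): the input is drawn from the same kernel and the discretized cost is a function of
  the gridded history and the input. The two processes differ in one point. The gridded state is
  resampled from \<open>Q(\<cdot>|\<xi>(x),u)\<close>, while the true state follows \<open>Q(\<cdot>|x,u)\<close>.

  On the safe set both measures have densities, and these differ pointwise by at most
  \<open>h\<^sub>x \<parallel>x - \<xi>(x)\<parallel> \<le> h\<^sub>x \<Delta>\<^sub>x\<close>. The safe set consists of \<open>M\<^sub>x\<close> cells of volume at most the maximal
  cell measure. Hence for every \<open>[0,1]\<close>-valued function that vanishes off the safe set the two
  integrals differ by at most the product of these quantities, which is the loss of one step
  (\<open>kern_representative_le\<close>).

  The losses are added up by a forward induction on the time \<open>k\<close> (\<open>value_comparison\<close>): for every
  measurable \<open>f \<le> 1\<close> on gridded histories, the gridded expectation of \<open>f\<close> on the event that \<open>x\<^sub>k\<close> is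
  safe exceeds the original expectation of \<open>f \<circ> psi\<close> on the event that all of \<open>x\<^sub>0, \<dots>, x\<^sub>k\<close> are safe by
  at most \<open>k\<close> times the loss of one step. Quantifying over all \<open>f\<close> is what makes the induction
  close, since averaging \<open>f\<close> over the last transition yields another such function. Absorption in the
  unsafe state reconciles the two events: a gridded path whose last state is safe has been safe all
  along. With \<open>f = 1\<close> at the horizon this bounds the gridded safety probability, which in turn
  dominates the constraint value \<open>\<alpha>\<close> because the final input merely weights that event by \<open>0\<close> or \<open>1\<close>.
  Only this direction is compared, with integrals in the extended non-negative reals, so that
  no differences of integrals have to be formed.\<close>

section \<open>Integration against the law of a controlled process\<close>

definition extend :: "nat \<Rightarrow> ('s, 'a) hist \<Rightarrow> 'a \<Rightarrow> 's \<Rightarrow> ('s, 'a) hist" where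
  "extend k h u s = ((fst h)(Suc k := s), (snd h)(k := u))"

lemma measurable_extend [measurable]:
  "(\<lambda>((h, u), s). extend k h u s) \<in> (hist_space S A k \<Otimes>\<^sub>M A) \<Otimes>\<^sub>M S \<rightarrow>\<^sub>M hist_space S A (Suc k)"
proof -
  have s: "{..Suc k} = insert (Suc k) {..k}" "{..<Suc k} = insert k {..<k}" by auto
  have *: "(\<lambda>p. (fst (fst (fst p)))(Suc k := snd p)) \<in>
      (hist_space S A k \<Otimes>\<^sub>M A) \<Otimes>\<^sub>M S \<rightarrow>\<^sub>M Pi\<^sub>M {..Suc k} (\<lambda>_. S)"
    using measurable_compose[OF _ measurable_add_dim[of "Suc k" "{..k}" "\<lambda>_. S"],
      of "\<lambda>p. (fst (fst (fst p)), snd p)" "(hist_space S A k \<Otimes>\<^sub>M A) \<Otimes>\<^sub>M S"]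
    unfolding s hist_space_def by simp
  have **: "(\<lambda>p. (snd (fst (fst p)))(k := snd (fst p))) \<in>
      (hist_space S A k \<Otimes>\<^sub>M A) \<Otimes>\<^sub>M S \<rightarrow>\<^sub>M Pi\<^sub>M {..<Suc k} (\<lambda>_. A)"
    using measurable_compose[OF _ measurable_add_dim[of k "{..<k}" "\<lambda>_. A"],
      of "\<lambda>p. (snd (fst (fst p)), snd (fst p))" "(hist_space S A k \<Otimes>\<^sub>M A) \<Otimes>\<^sub>M S"]
    unfolding s hist_space_def by simp
  show ?thesis
    using measurable_Pair[OF * **]
    by (simp add: extend_def hist_space_def case_prod_beta')
qed

lemma extend_in_space:
  assumes "h \<in> space (hist_space S A k)" "u \<in> space A" "s \<in> space S"
  shows "extend k h u s \<in> space (hist_space S A (Suc k))"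
  using measurable_space[OF measurable_extend, of "((h, u), s)"] assms
  by (simp add: space_pair_measure)

lemma measurable_state [measurable (raw)]:
  "i \<le> k \<Longrightarrow> (\<lambda>h. fst h i) \<in> hist_space S A k \<rightarrow>\<^sub>M S"
  unfolding hist_space_def by measurable

lemma measurable_input [measurable (raw)]:
  "i < k \<Longrightarrow> (\<lambda>h. snd h i) \<in> hist_space S A k \<rightarrow>\<^sub>M A"
  unfolding hist_space_def by measurable

lemma space_hist_space_state: "h \<in> space (hist_space S A k) \<Longrightarrow> i \<le> k \<Longrightarrow> fst h i \<in> space S"
  by (rule measurable_space[OF measurable_state])

text \<open>The locale is instantiated twice, with the original process run under the adapted policy and
  with the gridded process. Its kernels are stochastic at times \<open>k < N\<close> only, because stage costs
  are non-negative only before the horizon, and a negative cost could move the accumulated cost out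
  of its range, where the gridded kernel loses mass.\<close>

locale controlled_process =
  fixes S :: "'s measure" and A :: "'a measure" and K :: "nat \<Rightarrow> 's \<Rightarrow> 'a \<Rightarrow> 's measure"
    and \<pi> :: "nat \<Rightarrow> ('s, 'a) hist \<Rightarrow> 'a measure" and s0 :: 's and N :: nat
  assumes s0: "s0 \<in> space S"
    and policy: "\<pi> \<in> policies S A N"
    and kernel: "\<And>k. k < N \<Longrightarrow> (\<lambda>(s, u). K k s u) \<in> S \<Otimes>\<^sub>M A \<rightarrow>\<^sub>M prob_algebra S"
begin

abbreviation law :: "nat \<Rightarrow> ('s, 'a) hist measure" where
  "law \<equiv> hist_law S A K \<pi> s0"

lemma measurable_policy: "k < N \<Longrightarrow> \<pi> k \<in> hist_space S A k \<rightarrow>\<^sub>M prob_algebra A"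
  using policy by (simp add: policies_def)

lemma measurable_kernel:
  "k < N \<Longrightarrow> (\<lambda>(h, u). K k (fst h k) u) \<in> hist_space S A k \<Otimes>\<^sub>M A \<rightarrow>\<^sub>M prob_algebra S"
  using measurable_compose[OF
      measurable_Pair[OF measurable_compose[OF measurable_fst measurable_state[OF order_refl]] measurable_snd]
      kernel[of k]]
  by (simp add: case_prod_beta')

lemma measurable_move:
  assumes "k < N"
  shows "(\<lambda>(h, u). K k (fst h k) u \<bind> (\<lambda>s. return (hist_space S A (Suc k)) (extend k h u s)))
    \<in> hist_space S A k \<Otimes>\<^sub>M A \<rightarrow>\<^sub>M prob_algebra (hist_space S A (Suc k))"
proof -
  have "(\<lambda>p. K k (fst (fst p) k) (snd p) \<bind>
           (\<lambda>s. return (hist_space S A (Suc k)) (extend k (fst p) (snd p) s)))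
    \<in> hist_space S A k \<Otimes>\<^sub>M A \<rightarrow>\<^sub>M prob_algebra (hist_space S A (Suc k))"
  proof (rule measurable_bind_prob_space2)
    show "(\<lambda>p. K k (fst (fst p) k) (snd p)) \<in> hist_space S A k \<Otimes>\<^sub>M A \<rightarrow>\<^sub>M prob_algebra S"
      using measurable_kernel[OF assms] by (simp add: case_prod_beta')
    show "(\<lambda>(p, s). return (hist_space S A (Suc k)) (extend k (fst p) (snd p) s))
      \<in> (hist_space S A k \<Otimes>\<^sub>M A) \<Otimes>\<^sub>M S \<rightarrow>\<^sub>M prob_algebra (hist_space S A (Suc k))"
      using measurable_compose[OF measurable_extend measurable_return_prob_space]
      by (simp add: case_prod_beta')
  qed
  then show ?thesis by (simp add: case_prod_beta')
qed

lemma measurable_step: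
  assumes "k < N"
  shows "(\<lambda>h. \<pi> k h \<bind> (\<lambda>u. K k (fst h k) u \<bind>
      (\<lambda>s. return (hist_space S A (Suc k)) (extend k h u s))))
    \<in> hist_space S A k \<rightarrow>\<^sub>M prob_algebra (hist_space S A (Suc k))"
  by (rule measurable_bind_prob_space2[OF measurable_policy[OF assms] measurable_move[OF assms]])

lemma law_Suc:
  "law (Suc k) = law k \<bind> (\<lambda>h. \<pi> k h \<bind> (\<lambda>u. K k (fst h k) u \<bind>
      (\<lambda>s. return (hist_space S A (Suc k)) (extend k h u s))))"
  by (simp add: extend_def)

lemma law_in_prob_algebra: "k \<le> N \<Longrightarrow> law k \<in> space (prob_algebra (hist_space S A k))"
proof (induction k)
  case 0
  have "(\<lambda>i\<in>{..0}. s0, \<lambda>i\<in>{..<0}. undefined) \<in> space (hist_space S A 0)"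
    using s0 by (auto simp: hist_space_def space_pair_measure space_PiM)
  then show ?case
    using measurable_space[OF measurable_return_prob_space] by auto
next
  case (Suc k)
  then show ?case
    unfolding law_Suc
    using measurable_space[OF measurable_bind_prob_space[OF measurable_const measurable_step, of "law k" k "count_space UNIV"]]
    by auto
qed

lemma sets_law: "k \<le> N \<Longrightarrow> sets (law k) = sets (hist_space S A k)"
  using law_in_prob_algebra by (auto simp: space_prob_algebra)

lemma space_law: "k \<le> N \<Longrightarrow> space (law k) = space (hist_space S A k)"
  using sets_law sets_eq_imp_space_eq by blast

lemma prob_space_law: "k \<le> N \<Longrightarrow> prob_space (law k)"
  using law_in_prob_algebra by (auto simp: space_prob_algebra)

lemma measurable_law: "k \<le> N \<Longrightarrow> (f \<in> law k \<rightarrow>\<^sub>M B) = (f \<in> hist_space S A k \<rightarrow>\<^sub>M B)"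
  using measurable_cong_sets[OF sets_law refl] by blast

lemma policy_in_prob_algebra:
  "k < N \<Longrightarrow> h \<in> space (hist_space S A k) \<Longrightarrow> \<pi> k h \<in> space (prob_algebra A)"
  by (rule measurable_space[OF measurable_policy])

lemma kernel_in_prob_algebra:
  "k < N \<Longrightarrow> s \<in> space S \<Longrightarrow> u \<in> space A \<Longrightarrow> K k s u \<in> space (prob_algebra S)"
  using measurable_space[OF kernel, of k "(s, u)"] by (simp add: space_pair_measure)

lemma measurable_kernel_integral:
  assumes "k < N" and [measurable]: "f \<in> borel_measurable (hist_space S A (Suc k))"
  shows "(\<lambda>(h, u). \<integral>\<^sup>+s. f (extend k h u s) \<partial>K k (fst h k) u) \<in> borel_measurable (hist_space S A k \<Otimes>\<^sub>M A)"
proof -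
  have "(\<lambda>p. \<integral>\<^sup>+s. f (extend k (fst p) (snd p) s) \<partial>K k (fst (fst p) k) (snd p))
     \<in> borel_measurable (hist_space S A k \<Otimes>\<^sub>M A)"
  proof (rule nn_integral_measurable_subprob_algebra2)
    show "(\<lambda>(p, s). f (extend k (fst p) (snd p) s)) \<in> borel_measurable ((hist_space S A k \<Otimes>\<^sub>M A) \<Otimes>\<^sub>M S)"
      using measurable_compose[OF measurable_extend assms(2)] by (simp add: case_prod_beta')
    show "(\<lambda>p. K k (fst (fst p) k) (snd p)) \<in> hist_space S A k \<Otimes>\<^sub>M A \<rightarrow>\<^sub>M subprob_algebra S"
      using measurable_prob_algebraD[OF measurable_kernel[OF assms(1)]] by (simp add: case_prod_beta')
  qed
  then show ?thesis by (simp add: case_prod_beta')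
qed

lemma measurable_step_integral:
  assumes "k < N" "f \<in> borel_measurable (hist_space S A (Suc k))"
  shows "(\<lambda>h. \<integral>\<^sup>+u. \<integral>\<^sup>+s. f (extend k h u s) \<partial>K k (fst h k) u \<partial>\<pi> k h)
    \<in> borel_measurable (hist_space S A k)"
  using measurable_kernel_integral[OF assms] measurable_prob_algebraD[OF measurable_policy[OF assms(1)]]
  by (rule nn_integral_measurable_subprob_algebra2)

text \<open>The recursion for the law of histories in the form used below: expectations at time \<open>k + 1\<close> are
  expectations at time \<open>k\<close> of the average over the next input and the next state.\<close>

lemma nn_integral_law_Suc:
  assumes k: "k < N" and f: "f \<in> borel_measurable (hist_space S A (Suc k))"
  shows "(\<integral>\<^sup>+h. f h \<partial>law (Suc k)) =
    (\<integral>\<^sup>+h. \<integral>\<^sup>+u. \<integral>\<^sup>+s. f (extend k h u s) \<partial>K k (fst h k) u \<partial>\<pi> k h \<partial>law k)"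
proof -
  let ?H = "hist_space S A (Suc k)"
  let ?step = "\<lambda>h. \<pi> k h \<bind> (\<lambda>u. K k (fst h k) u \<bind> (\<lambda>s. return ?H (extend k h u s)))"
  have "(\<integral>\<^sup>+h. f h \<partial>law (Suc k)) = (\<integral>\<^sup>+h. \<integral>\<^sup>+g. f g \<partial>?step h \<partial>law k)"
    unfolding law_Suc
    by (rule nn_integral_bind[OF f])
       (use k measurable_prob_algebraD[OF measurable_step[OF k]] in \<open>simp add: measurable_law\<close>)
  also have "\<dots> = (\<integral>\<^sup>+h. \<integral>\<^sup>+u. \<integral>\<^sup>+s. f (extend k h u s) \<partial>K k (fst h k) u \<partial>\<pi> k h \<partial>law k)"
  proof (rule nn_integral_cong)
    fix h assume "h \<in> space (law k)"
    then have h: "h \<in> space (hist_space S A k)" using k by (simp add: space_law)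
    have setsP: "sets (\<pi> k h) = sets A"
      using policy_in_prob_algebra[OF k h] by (simp add: space_prob_algebra)
    have "(\<integral>\<^sup>+g. f g \<partial>?step h) =
        (\<integral>\<^sup>+u. \<integral>\<^sup>+g. f g \<partial>(K k (fst h k) u \<bind> (\<lambda>s. return ?H (extend k h u s))) \<partial>\<pi> k h)"
    proof (rule nn_integral_bind[OF f])
      have "(\<lambda>u. K k (fst h k) u \<bind> (\<lambda>s. return ?H (extend k h u s))) \<in> A \<rightarrow>\<^sub>M subprob_algebra ?H"
        using measurable_compose[OF measurable_Pair1'[OF h] measurable_prob_algebraD[OF measurable_move[OF k]]]
        by simp
      then show "(\<lambda>u. K k (fst h k) u \<bind> (\<lambda>s. return ?H (extend k h u s))) \<in> \<pi> k h \<rightarrow>\<^sub>M subprob_algebra ?H"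
        using measurable_cong_sets[OF setsP refl] by blast
    qed
    also have "\<dots> = (\<integral>\<^sup>+u. \<integral>\<^sup>+s. f (extend k h u s) \<partial>K k (fst h k) u \<partial>\<pi> k h)"
    proof (rule nn_integral_cong)
      fix u assume "u \<in> space (\<pi> k h)"
      then have u: "u \<in> space A" using sets_eq_imp_space_eq[OF setsP] by simp
      have setsK: "sets (K k (fst h k) u) = sets S"
        using kernel_in_prob_algebra[OF k space_hist_space_state[OF h] u] by (simp add: space_prob_algebra)
      have e: "extend k h u \<in> S \<rightarrow>\<^sub>M ?H"
        using measurable_compose[OF measurable_Pair1'[of "(h, u)" "hist_space S A k \<Otimes>\<^sub>M A" S] measurable_extend] h u
        by (simp add: space_pair_measure)
      have r: "(\<lambda>s. return ?H (extend k h u s)) \<in> K k (fst h k) u \<rightarrow>\<^sub>M subprob_algebra ?H"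
        using measurable_compose[OF e return_measurable] measurable_cong_sets[OF setsK refl] by blast
      show "(\<integral>\<^sup>+g. f g \<partial>(K k (fst h k) u \<bind> (\<lambda>s. return ?H (extend k h u s)))) =
          (\<integral>\<^sup>+s. f (extend k h u s) \<partial>K k (fst h k) u)"
        unfolding nn_integral_bind[OF f r]
        using sets_eq_imp_space_eq[OF setsK]
        by (intro nn_integral_cong nn_integral_return f) (auto intro: measurable_space[OF e])
    qed
    finally show "(\<integral>\<^sup>+g. f g \<partial>?step h) = (\<integral>\<^sup>+u. \<integral>\<^sup>+s. f (extend k h u s) \<partial>K k (fst h k) u \<partial>\<pi> k h)" .
  qed
  finally show ?thesis .
qed

lemma nn_integral_law_0:
  "f \<in> borel_measurable (hist_space S A 0) \<Longrightarrow>
    (\<integral>\<^sup>+h. f h \<partial>law 0) = f (\<lambda>i\<in>{..0}. s0, \<lambda>i\<in>{..<0}. undefined)"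
  unfolding hist_law.simps
  by (rule nn_integral_return) (use s0 in \<open>auto simp: hist_space_def space_pair_measure space_PiM\<close>)

end


section \<open>Cells and representatives\<close>

lemma partition_unique:
  assumes "is_partition m A r S" "i \<in> {1..m}" "j \<in> {1..m}" "s \<in> A i" "s \<in> A j"
  shows "i = j"
  using assms unfolding is_partition_def disjoint_family_on_def by blast

lemma partition_cover: "is_partition m A r S \<Longrightarrow> (\<Union>j\<in>{1..m}. A j) = S"
  and partition_rep: "is_partition m A r S \<Longrightarrow> j \<in> {1..m} \<Longrightarrow> r j \<in> A j"
  and partition_borel: "is_partition m A r S \<Longrightarrow> j \<in> {1..m} \<Longrightarrow> A j \<in> sets borel"
  unfolding is_partition_def by blast+

lemma representative_eq:
  assumes "is_partition m A r S" "j \<in> {1..m}" "s \<in> A j"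
  shows "representative m A r s = r j"
proof -
  have "(THE j. j \<in> {1..m} \<and> s \<in> A j) = j"
    using assms partition_unique[OF assms(1)] by blast
  then show ?thesis by (simp add: representative_def)
qed

lemma representative_cell:
  assumes "is_partition m A r S" "s \<in> S"
  obtains j where "j \<in> {1..m}" "s \<in> A j" "representative m A r s = r j"
proof -
  from assms(2) obtain j where "j \<in> {1..m}" "s \<in> A j"
    unfolding partition_cover[OF assms(1), symmetric] by blast
  with representative_eq[OF assms(1)] show ?thesis using that by blast
qed

lemma representative_in_cells:
  assumes "is_partition m A r S" "s \<in> S"
  shows "representative m A r s \<in> r ` {1..m}"
  by (rule representative_cell[OF assms]) blast

lemma representatives_subset: "is_partition m A r S \<Longrightarrow> r ` {1..m} \<subseteq> S"
  using partition_cover partition_rep by fast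

lemma representative_fixed:
  assumes "is_partition m A r S" "s \<in> r ` {1..m}"
  shows "representative m A r s = s"
  using assms(2) representative_eq[OF assms(1)] partition_rep[OF assms(1)] by fastforce

text \<open>Representatives of different cells differ, since each lies in its own cell and the cells are
  disjoint. So the fibres of the gridding map are exactly the cells.\<close>

lemma representative_vimage:
  assumes "is_partition m A r S" "j \<in> {1..m}"
  shows "representative m A r -` {r j} \<inter> S = A j"
proof (intro equalityI subsetI)
  fix s assume "s \<in> representative m A r -` {r j} \<inter> S"
  then have s: "s \<in> S" "representative m A r s = r j" by auto
  obtain i where i: "i \<in> {1..m}" "s \<in> A i" "representative m A r s = r i"
    using representative_cell[OF assms(1) s(1)] by blast
  have "r j \<in> A i" using partition_rep[OF assms(1) i(1)] i(3) s(2) by simp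
  then have "i = j"
    using partition_unique[OF assms(1) i(1) assms(2)] partition_rep[OF assms] by blast
  then show "s \<in> A j" using i by simp
next
  fix s assume "s \<in> A j"
  then show "s \<in> representative m A r -` {r j} \<inter> S"
    using assms(2) partition_cover[OF assms(1)] representative_eq[OF assms] by auto
qed

lemma measurable_representative:
  assumes "is_partition m A r S"
  shows "representative m A r \<in> restrict_space borel S \<rightarrow>\<^sub>M count_space (r ` {1..m})"
proof -
  have "A j \<in> sets (restrict_space borel S)" if "j \<in> {1..m}" for j
  proof -
    have "A j = S \<inter> A j" "A j \<in> sets borel"
      using partition_cover[OF assms] partition_borel[OF assms] that by auto
    then show ?thesis by (auto simp: sets_restrict_space)
  qed
  then show ?thesis
    using representative_in_cells[OF assms] representative_vimage[OF assms]
    by (auto simp: measurable_count_space_eq2 space_restrict_space)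
qed

locale gridded_mdp =
  fixes M :: "('x::euclidean_space, 'u::polish_space) mdp" and G :: "('x, 'u) grid"
  assumes mdp: "is_mdp M" and grid: "is_grid M G"
begin

abbreviation "gstates \<equiv> count_space (grid_states M G)"
abbreviation "ginputs \<equiv> count_space (grid_inputs G)"
abbreviation "xreps \<equiv> xrep G ` {1..Mx G} \<union> {xdag M}"
abbreviation "creps \<equiv> crep G ` {1..Mc G}"

lemma partition_x: "is_partition (Mx G) (xcell G) (xrep G) (safe M)"
  and partition_c: "is_partition (Mc G) (ccell G) (crep G) (costs M)"
  and partition_u: "is_partition (Mu G) (ucell G) (urep G) (inputs M)"
  and zero_in_creps: "0 \<in> creps"
  using grid unfolding is_grid_def by blast+

lemma space_state_space [simp]: "space (state_space M) = states M"
  and space_input_space [simp]: "space (input_space M) = inputs M"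
  by (auto simp: state_space_def input_space_def space_restrict_space)

lemma states_eq: "states M = safe M \<union> {xdag M}" and xdag_unsafe: "xdag M \<notin> safe M"
  and safe_sets [measurable]: "safe M \<in> sets (state_space M)"
  and states_borel: "states M \<in> sets borel"
  using mdp unfolding is_mdp_def by blast+

lemma safe_borel: "safe M \<in> sets borel"
  using safe_sets states_borel by (auto simp: state_space_def sets_restrict_space_iff)

lemma measurable_kern:
  "(\<lambda>(x, u). kern M x u) \<in> state_space M \<Otimes>\<^sub>M input_space M \<rightarrow>\<^sub>M prob_algebra (state_space M)"
  using mdp unfolding is_mdp_def by blast

lemma kern_in_prob_algebra:
  "x \<in> states M \<Longrightarrow> u \<in> inputs M \<Longrightarrow> kern M x u \<in> space (prob_algebra (state_space M))"
  using measurable_space[OF measurable_kern, of "(x, u)"] by (simp add: space_pair_measure)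

lemma sets_kern: "x \<in> states M \<Longrightarrow> u \<in> inputs M \<Longrightarrow> sets (kern M x u) = sets (state_space M)"
  using kern_in_prob_algebra by (auto simp: space_prob_algebra)

lemma space_kern: "x \<in> states M \<Longrightarrow> u \<in> inputs M \<Longrightarrow> space (kern M x u) = states M"
  using sets_eq_imp_space_eq[OF sets_kern] by simp

lemma prob_space_kern: "x \<in> states M \<Longrightarrow> u \<in> inputs M \<Longrightarrow> prob_space (kern M x u)"
  using kern_in_prob_algebra by (auto simp: space_prob_algebra)

lemma measurable_on_kern:
  "x \<in> states M \<Longrightarrow> u \<in> inputs M \<Longrightarrow> (f \<in> kern M x u \<rightarrow>\<^sub>M B) = (f \<in> state_space M \<rightarrow>\<^sub>M B)"
  using measurable_cong_sets[OF sets_kern refl] by blast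

lemma stage_cost_nonneg:
  "k < horizon M \<Longrightarrow> x \<in> states M \<Longrightarrow> u \<in> inputs M \<Longrightarrow> 0 \<le> stage_cost M k x u"
  using mdp unfolding is_mdp_def by blast

lemma creps_subset: "creps \<subseteq> costs M"
  by (rule representatives_subset[OF partition_c])

lemma Cmax_nonneg: "0 \<le> Cmax M"
  using subsetD[OF creps_subset zero_in_creps] by (simp add: costs_def)

lemma grid_inputs_subset: "grid_inputs G \<subseteq> inputs M"
  using representatives_subset[OF partition_u] by (simp add: grid_inputs_def)

lemma xi_u_fixed: "u \<in> grid_inputs G \<Longrightarrow> xi_u G u = u"
  unfolding xi_u_def grid_inputs_def by (rule representative_fixed[OF partition_u])

lemma xi_c_in: "c \<in> costs M \<Longrightarrow> xi_c G c \<in> creps"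
  unfolding xi_c_def by (rule representative_in_cells[OF partition_c])

lemma xi_x_safe_eq: "x \<in> safe M \<Longrightarrow> xi_x M G x = representative (Mx G) (xcell G) (xrep G) x"
  using xdag_unsafe by (auto simp: xi_x_def)

lemma xi_x_in: "x \<in> states M \<Longrightarrow> xi_x M G x \<in> xreps"
  using representative_in_cells[OF partition_x, of x] by (auto simp: states_eq xi_x_def)

lemma xreps_subset: "xreps \<subseteq> states M"
  using representatives_subset[OF partition_x] by (auto simp: states_eq)

lemma xi_x_states: "x \<in> states M \<Longrightarrow> xi_x M G x \<in> states M"
  using xi_x_in xreps_subset by blast

lemma xi_x_safe_iff: "x \<in> states M \<Longrightarrow> xi_x M G x \<in> safe M \<longleftrightarrow> x \<in> safe M"
  using representative_in_cells[OF partition_x, of x] representatives_subset[OF partition_x] xdag_unsafe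
  by (auto simp: states_eq xi_x_def)

lemma grid_statesD:
  assumes "z \<in> grid_states M G" shows "fst z \<in> states M" "snd z \<in> costs M"
  using assms xreps_subset creps_subset by (auto simp: grid_states_def)

lemma xi_x_dag_iff: "x \<in> states M \<Longrightarrow> xi_x M G x = xdag M \<longleftrightarrow> x \<notin> safe M"
  using xi_x_safe_iff[of x] xdag_unsafe by (auto simp: states_eq xi_x_def)

lemma measurable_xi_x [measurable]: "xi_x M G \<in> state_space M \<rightarrow>\<^sub>M count_space xreps"
proof -
  have "xi_x M G -` {a} \<inter> states M \<in> sets (state_space M)" if a: "a \<in> xreps" for a
  proof (cases "a = xdag M")
    case True
    have "xi_x M G -` {a} \<inter> states M = states M - safe M"
      unfolding True using xi_x_dag_iff by blast
    then show ?thesis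
      using sets.compl_sets[OF safe_sets] by simp
  next
    case False
    then obtain j where j: "j \<in> {1..Mx G}" "a = xrep G j" using a by blast
    have "xi_x M G -` {a} \<inter> states M = xi_x M G -` {a} \<inter> safe M"
      using False xi_x_dag_iff states_eq by blast
    also have "\<dots> = representative (Mx G) (xcell G) (xrep G) -` {xrep G j} \<inter> safe M"
      unfolding j(2) using xi_x_safe_eq by fastforce
    also have "\<dots> = xcell G j" by (rule representative_vimage[OF partition_x j(1)])
    finally have eq: "xi_x M G -` {a} \<inter> states M = xcell G j" .
    have "xcell G j \<subseteq> states M"
      using partition_cover[OF partition_x] j(1) states_eq by blast
    then show ?thesis
      unfolding eq using partition_borel[OF partition_x j(1)] states_borel
      by (simp add: state_space_def sets_restrict_space_iff)
  qed
  moreover have "finite xreps" by simp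
  moreover have "xi_x M G \<in> states M \<rightarrow> xreps" using xi_x_in by (rule Pi_I)
  ultimately show ?thesis
    unfolding measurable_count_space_eq2[OF \<open>finite xreps\<close>] space_state_space by blast
qed

lemma measurable_xi_u [measurable]: "xi_u G \<in> input_space M \<rightarrow>\<^sub>M ginputs"
  unfolding xi_u_def input_space_def grid_inputs_def by (rule measurable_representative[OF partition_u])

lemma measurable_xi_c [measurable]: "xi_c G \<in> restrict_space borel (costs M) \<rightarrow>\<^sub>M count_space creps"
  unfolding xi_c_def by (rule measurable_representative[OF partition_c])


section \<open>The gridded kernel as an image of the original one\<close>

definition next_cost :: "nat \<Rightarrow> 'x \<times> real \<Rightarrow> 'u \<Rightarrow> real" where
  "next_cost k z u = xi_c G (min (Cmax M) (snd z + stage_cost M k (fst z) u))"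

lemma aug_cost_in_costs:
  "k < horizon M \<Longrightarrow> x \<in> states M \<Longrightarrow> c \<in> costs M \<Longrightarrow> u \<in> inputs M \<Longrightarrow>
    min (Cmax M) (c + stage_cost M k x u) \<in> costs M"
  using stage_cost_nonneg[of k x u] Cmax_nonneg by (auto simp: costs_def)

lemma next_cost_in:
  assumes "k < horizon M" "z \<in> grid_states M G" "u \<in> inputs M"
  shows "next_cost k z u \<in> creps"
  unfolding next_cost_def
  using assms grid_statesD[OF assms(2)] by (intro xi_c_in aug_cost_in_costs) auto

lemma measurable_grid_state:
  assumes "c \<in> creps"
  shows "(\<lambda>y. (xi_x M G y, c)) \<in> state_space M \<rightarrow>\<^sub>M gstates"
proof -
  have "(\<lambda>y. (xi_x M G y, c)) \<in> state_space M \<rightarrow>\<^sub>M count_space xreps \<Otimes>\<^sub>M count_space creps"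
    using assms by (intro measurable_Pair measurable_xi_x measurable_const) simp
  then show ?thesis
    by (simp add: pair_measure_countable grid_states_def)
qed

text \<open>The gridded kernel is defined by its point masses, the probabilities of product cells. As the
  cost coordinate of the augmented kernel is deterministic, it is the law of the gridded successor
  of the state alone. In this form integrals over the two kernels can be compared without
  summing over cells.\<close>

lemma grid_kern_eq_distr:
  assumes k: "k < horizon M" and z: "z \<in> grid_states M G" and u: "u \<in> inputs M"
  shows "grid_kern M G k z u =
    distr (kern M (fst z) u) gstates (\<lambda>y. (xi_x M G y, next_cost k z u))"
proof (rule measure_eqI_finite)
  show fin: "finite (grid_states M G)" by (simp add: grid_states_def)
  show "sets (grid_kern M G k z u) = Pow (grid_states M G)"
    by (simp add: grid_kern_def sets_point_measure)
  show "sets (distr (kern M (fst z) u) gstates (\<lambda>y. (xi_x M G y, next_cost k z u))) = Pow (grid_states M G)"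
    by simp
  fix a assume a: "a \<in> grid_states M G"
  note zx = grid_statesD[OF z]
  define c where "c = min (Cmax M) (snd z + stage_cost M k (fst z) u)"
  have c: "c \<in> costs M" unfolding c_def by (rule aug_cost_in_costs[OF k zx u])
  let ?C = "restrict_space borel (costs M)"
  have cs: "c \<in> space ?C" using c by (simp add: space_restrict_space)
  interpret R: prob_space "return ?C c" by (rule prob_space_return[OF cs])
  have zc_eq: "zcell M G a = (xi_x M G -` {fst a} \<inter> states M) \<times> (xi_c G -` {snd a} \<inter> costs M)"
    by (cases a) (auto simp: zcell_def)
  have m1: "xi_x M G -` {fst a} \<inter> states M \<in> sets (state_space M)"
    using measurable_sets[OF measurable_xi_x, of "{fst a}"] a by (auto simp: grid_states_def)
  have m2: "xi_c G -` {snd a} \<inter> costs M \<in> sets ?C"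
    using measurable_sets[OF measurable_xi_c, of "{snd a}"] a
    by (auto simp: grid_states_def space_restrict_space)
  have "emeasure (grid_kern M G k z u) {a} = emeasure (aug_kern M k z u) (zcell M G a)"
    using a fin by (simp add: grid_kern_def emeasure_point_measure_finite)
  also have "\<dots> = emeasure (kern M (fst z) u) (xi_x M G -` {fst a} \<inter> states M) *
      emeasure (return ?C c) (xi_c G -` {snd a} \<inter> costs M)"
    unfolding aug_kern_def zc_eq c_def[symmetric]
    by (rule R.emeasure_pair_measure_Times) (use m1 m2 sets_kern[OF zx(1) u] in auto)
  also have "\<dots> = emeasure (kern M (fst z) u) ((\<lambda>y. (xi_x M G y, xi_c G c)) -` {a} \<inter> states M)"
    using m2 c by (cases a) (auto simp: emeasure_return indicator_def vimage_def intro!: arg_cong[where f="emeasure _"])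
  also have "\<dots> = emeasure (distr (kern M (fst z) u) gstates (\<lambda>y. (xi_x M G y, next_cost k z u))) {a}"
    using a measurable_grid_state[OF next_cost_in[OF k z u]] space_kern[OF zx(1) u]
    by (subst emeasure_distr) (auto simp: measurable_on_kern[OF zx(1) u] next_cost_def c_def)
  finally show "emeasure (grid_kern M G k z u) {a} =
    emeasure (distr (kern M (fst z) u) gstates (\<lambda>y. (xi_x M G y, next_cost k z u))) {a}" .
qed

lemma measurable_grid_kern:
  assumes "k < horizon M"
  shows "(\<lambda>(z, u). grid_kern M G k z u) \<in> gstates \<Otimes>\<^sub>M ginputs \<rightarrow>\<^sub>M prob_algebra gstates"
proof -
  have "grid_kern M G k z u \<in> space (prob_algebra gstates)"
    if z: "z \<in> grid_states M G" and u: "u \<in> grid_inputs G" for z u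
  proof -
    have u': "u \<in> inputs M" using u grid_inputs_subset by blast
    have "(\<lambda>y. (xi_x M G y, next_cost k z u)) \<in> kern M (fst z) u \<rightarrow>\<^sub>M gstates"
      using measurable_grid_state[OF next_cost_in[OF assms z u']]
      by (simp add: measurable_on_kern[OF grid_statesD(1)[OF z] u'])
    then show ?thesis
      unfolding grid_kern_eq_distr[OF assms z u']
      using prob_space.prob_space_distr[OF prob_space_kern[OF grid_statesD(1)[OF z] u']]
      by (simp add: space_prob_algebra)
  qed
  then show ?thesis
    by (subst pair_measure_countable)
       (auto simp: grid_states_def grid_inputs_def measurable_count_space_eq1)
qed

lemma nn_integral_grid_kern:
  assumes k: "k < horizon M" and z: "z \<in> grid_states M G" and u: "u \<in> inputs M"
  shows "(\<integral>\<^sup>+s. f s \<partial>grid_kern M G k z u) =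
    (\<integral>\<^sup>+y. f (xi_x M G y, next_cost k z u) \<partial>kern M (fst z) u)"
  unfolding grid_kern_eq_distr[OF assms]
  using measurable_grid_state[OF next_cost_in[OF assms]]
  by (subst nn_integral_distr) (auto simp: measurable_on_kern[OF grid_statesD(1)[OF z] u])

text \<open>Absorption: once unsafe, the process contributes nothing to integrals over the safe set.\<close>

lemma kern_xdag_safe:
  assumes "u \<in> inputs M"
  shows "(\<integral>\<^sup>+y. f y * indicator (safe M) y \<partial>kern M (xdag M) u) = 0"
proof -
  have x: "xdag M \<in> states M" by (simp add: states_eq)
  interpret prob_space "kern M (xdag M) u" by (rule prob_space_kern[OF x assms])
  have "measure (kern M (xdag M) u) {xdag M} = 1" using mdp assms unfolding is_mdp_def by blast
  then have "AE y in kern M (xdag M) u. y \<in> {xdag M}" by (rule AE_prob_1)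
  then have "AE y in kern M (xdag M) u. f y * indicator (safe M) y = 0"
    using xdag_unsafe by (auto elim!: eventually_mono)
  then have "(\<integral>\<^sup>+y. f y * indicator (safe M) y \<partial>kern M (xdag M) u) = (\<integral>\<^sup>+y. 0 \<partial>kern M (xdag M) u)"
    by (rule nn_integral_cong_AE)
  then show ?thesis by simp
qed


section \<open>Gridding of histories\<close>

text \<open>The discretized cost is a real number, but it is measurable even into the discrete space of cost
  representatives: it is computed from finitely many values by functions on finite sets, so the
  stage costs enter only through their values at representatives.\<close>

lemma measurable_zeta:
  "i \<le> k \<Longrightarrow> k \<le> horizon M \<Longrightarrow>
    (\<lambda>h. zeta M G h i) \<in> hist_space (state_space M) (input_space M) k \<rightarrow>\<^sub>M count_space creps"
proof (induction i)
  case 0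
  then show ?case using zero_in_creps by simp
next
  case (Suc i)
  let ?H = "hist_space (state_space M) (input_space M) k"
  have i: "i < horizon M" "i < k" using Suc.prems by auto
  have "(\<lambda>h. ((xi_x M G (fst h i), zeta M G h i), xi_u G (snd h i)))
      \<in> ?H \<rightarrow>\<^sub>M (count_space xreps \<Otimes>\<^sub>M count_space creps) \<Otimes>\<^sub>M ginputs"
    using Suc.prems
    by (intro measurable_Pair Suc.IH measurable_compose[OF measurable_state measurable_xi_x]
      measurable_compose[OF measurable_input measurable_xi_u]) auto
  then have *: "(\<lambda>h. ((xi_x M G (fst h i), zeta M G h i), xi_u G (snd h i)))
      \<in> ?H \<rightarrow>\<^sub>M count_space (grid_states M G \<times> grid_inputs G)"
    by (simp add: pair_measure_countable grid_states_def grid_inputs_def)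
  have "(\<lambda>(z, u). next_cost i z u) \<in> count_space (grid_states M G \<times> grid_inputs G) \<rightarrow>\<^sub>M count_space creps"
    using next_cost_in[OF i(1)] grid_inputs_subset by (auto simp: measurable_count_space_eq1)
  from measurable_compose[OF * this] show ?case
    by (simp add: next_cost_def)
qed

lemma measurable_psi:
  assumes "k \<le> horizon M"
  shows "psi M G k \<in> hist_space (state_space M) (input_space M) k \<rightarrow>\<^sub>M hist_space gstates ginputs k"
proof -
  let ?H = "hist_space (state_space M) (input_space M) k"
  have "(\<lambda>h. (xi_x M G (fst h i), zeta M G h i)) \<in> ?H \<rightarrow>\<^sub>M gstates" if "i \<le> k" for i
  proof -
    have "(\<lambda>h. (xi_x M G (fst h i), zeta M G h i)) \<in> ?H \<rightarrow>\<^sub>M count_space xreps \<Otimes>\<^sub>M count_space creps"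
      using that assms
      by (intro measurable_Pair measurable_zeta measurable_compose[OF measurable_state measurable_xi_x])
    then show ?thesis by (simp add: pair_measure_countable grid_states_def)
  qed
  moreover have "(\<lambda>h. xi_u G (snd h i)) \<in> ?H \<rightarrow>\<^sub>M ginputs" if "i < k" for i
    using measurable_compose[OF measurable_input[OF that] measurable_xi_u] .
  ultimately have "(\<lambda>h. psi M G k h) \<in> ?H \<rightarrow>\<^sub>M Pi\<^sub>M {..k} (\<lambda>_. gstates) \<Otimes>\<^sub>M Pi\<^sub>M {..<k} (\<lambda>_. ginputs)"
    unfolding psi_def by (intro measurable_Pair measurable_restrict) auto
  then show ?thesis by (simp add: hist_space_def)
qed

lemma zeta_extend: "i \<le> k \<Longrightarrow> zeta M G (extend k h u y) i = zeta M G h i"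
  by (induction i) (auto simp: extend_def)

text \<open>The gridded history of a path evolves by the same update as a path of the gridded MDP: the
  discretized cost is a function of the gridded history alone. Only the law of the next gridded
  state differs, being drawn from the true state rather than from its representative.\<close>

lemma psi_extend:
  assumes "u \<in> grid_inputs G"
  shows "psi M G (Suc k) (extend k h u y) =
    extend k (psi M G k h) u (xi_x M G y, next_cost k (fst (psi M G k h) k) u)"
proof -
  have 1: "fst (psi M G (Suc k) (extend k h u y)) i =
      fst (extend k (psi M G k h) u (xi_x M G y, next_cost k (fst (psi M G k h) k) u)) i" for i
    by (cases "i = Suc k"; cases "i \<le> k")
       (auto simp: psi_def zeta_extend, auto simp: extend_def next_cost_def xi_u_fixed[OF assms])
  have 2: "snd (psi M G (Suc k) (extend k h u y)) i =
      snd (extend k (psi M G k h) u (xi_x M G y, next_cost k (fst (psi M G k h) k) u)) i" for i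
    by (cases "i = k") (auto simp: psi_def extend_def xi_u_fixed[OF assms])
  show ?thesis using 1 2 by (intro prod_eqI ext) auto
qed

end


section \<open>Error of a single transition\<close>

locale lipschitz_gridded_mdp = gridded_mdp M G
  for M :: "('x::euclidean_space, 'u::polish_space) mdp" and G :: "('x, 'u) grid" +
  fixes q :: "'x \<Rightarrow> 'x \<Rightarrow> 'u \<Rightarrow> real" and hx :: real
  assumes bounded_states: "bounded (states M)"
    and density: "has_density M q"
    and hx_nonneg: "0 \<le> hx"
    and lipschitz: "\<And>y x x' u. y \<in> states M \<Longrightarrow> x \<in> states M \<Longrightarrow> x' \<in> states M \<Longrightarrow> u \<in> inputs M \<Longrightarrow>
           \<bar>q y x u - q y x' u\<bar> \<le> hx * norm (x - x')"
begin

text \<open>An upper bound for the safety probability lost in one transition.\<close>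

definition step_error :: real where
  "step_error = hx * real (Mx G) * max_cell_measure G * grid_size G"

lemma xcell_subset: "j \<in> {1..Mx G} \<Longrightarrow> xcell G j \<subseteq> safe M"
  using partition_cover[OF partition_x] by blast

lemma bounded_xcell: "j \<in> {1..Mx G} \<Longrightarrow> bounded (xcell G j)"
  using bounded_subset[OF bounded_states] xcell_subset states_eq by blast

lemma diameter_le_grid_size: "j \<in> {1..Mx G} \<Longrightarrow> diameter (xcell G j) \<le> grid_size G"
  unfolding grid_size_def by (rule Max_ge) auto

lemma measure_le_max_cell: "j \<in> {1..Mx G} \<Longrightarrow> measure lborel (xcell G j) \<le> max_cell_measure G"
  unfolding max_cell_measure_def by (rule Max_ge) auto

lemma dist_xi_x_le:
  assumes "x \<in> safe M"
  shows "norm (x - xi_x M G x) \<le> grid_size G"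
proof -
  obtain j where j: "j \<in> {1..Mx G}" "x \<in> xcell G j" "xi_x M G x = xrep G j"
    using representative_cell[OF partition_x assms] xi_x_safe_eq[OF assms] by metis
  have "dist x (xi_x M G x) \<le> diameter (xcell G j)"
    using diameter_bounded_bound[OF bounded_xcell[OF j(1)] j(2)] partition_rep[OF partition_x j(1)] j(3)
    by simp
  then show ?thesis using diameter_le_grid_size[OF j(1)] by (simp add: dist_norm)
qed

text \<open>With no cells both maxima range over the empty set and their values are unspecified.\<close>

lemma cell_bounds_nonneg:
  assumes "Mx G \<noteq> 0" shows "0 \<le> grid_size G" "0 \<le> max_cell_measure G"
proof -
  have 1: "1 \<in> {1..Mx G}" using assms by simp
  show "0 \<le> grid_size G"
    using diameter_le_grid_size[OF 1] diameter_ge_0[OF bounded_xcell[OF 1]] by simp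
  show "0 \<le> max_cell_measure G"
    using measure_le_max_cell[OF 1] measure_nonneg[of lborel "xcell G 1"] by linarith
qed

lemma step_error_nonneg: "0 \<le> step_error"
  using cell_bounds_nonneg hx_nonneg by (cases "Mx G = 0") (auto simp: step_error_def)

lemma emeasure_safe_le: "emeasure lborel (safe M) \<le> ennreal (real (Mx G) * max_cell_measure G)"
proof -
  have "emeasure lborel (safe M) = emeasure lborel (\<Union>j\<in>{1..Mx G}. xcell G j)"
    by (simp only: partition_cover[OF partition_x])
  also have "\<dots> \<le> (\<Sum>j\<in>{1..Mx G}. emeasure lborel (xcell G j))"
    using partition_borel[OF partition_x] by (intro emeasure_subadditive_finite) auto
  also have "\<dots> \<le> (\<Sum>j\<in>{1..Mx G}. ennreal (max_cell_measure G))"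
  proof (rule sum_mono)
    fix j assume j: "j \<in> {1..Mx G}"
    have "emeasure lborel (xcell G j) = ennreal (measure lborel (xcell G j))"
      using emeasure_bounded_finite[OF bounded_xcell[OF j]] by (simp add: emeasure_eq_ennreal_measure)
    also have "\<dots> \<le> ennreal (max_cell_measure G)" by (rule ennreal_leI[OF measure_le_max_cell[OF j]])
    finally show "emeasure lborel (xcell G j) \<le> ennreal (max_cell_measure G)" .
  qed
  also have "\<dots> = ennreal (real (Mx G) * max_cell_measure G)"
    by (simp add: ennreal_mult' ennreal_of_nat_eq_real_of_nat)
  finally show ?thesis .
qed

lemma measurable_on_safe:
  assumes "f \<in> borel_measurable (state_space M)"
  shows "f \<in> borel_measurable (restrict_space lborel (safe M))"
proof -
  have "f \<in> borel_measurable (restrict_space borel (safe M))"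
    using measurable_restrict_mono[of f borel "states M" borel "safe M"] assms states_eq
    unfolding state_space_def by blast
  then show ?thesis
    by (simp add: measurable_cong_sets[OF sets_restrict_space_cong[OF sets_lborel] refl])
qed

lemma measurable_q:
  assumes x: "x \<in> states M" and u: "u \<in> inputs M"
  shows "(\<lambda>y. ennreal (q y x u)) \<in> borel_measurable (restrict_space lborel (safe M))"
proof -
  have "(\<lambda>y. q y x u) \<in> borel_measurable (state_space M)"
    using density x u unfolding has_density_def by blast
  then show ?thesis by (intro measurable_compose[OF _ measurable_ennreal] measurable_on_safe)
qed

text \<open>The density describes the kernel only on subsets of the safe set, so the identity of measures is
  stated after restriction to it; the kernel may have an atom at the unsafe state.\<close>

lemma restrict_kern_safe:
  assumes x: "x \<in> states M" and u: "u \<in> inputs M"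
  shows "restrict_space (kern M x u) (safe M) =
    density (restrict_space lborel (safe M)) (\<lambda>y. ennreal (q y x u))"
proof (rule measure_eqI)
  have sub: "safe M \<subseteq> states M" using states_eq by blast
  have "sets (restrict_space (kern M x u) (safe M)) = sets (restrict_space (state_space M) (safe M))"
    by (rule sets_restrict_space_cong[OF sets_kern[OF x u]])
  also have "restrict_space (state_space M) (safe M) = restrict_space borel (safe M)"
    using sub unfolding state_space_def
    by (subst restrict_restrict_space) (auto simp: states_borel safe_borel Int_absorb1)
  also have "sets (restrict_space borel (safe M)) = sets (restrict_space lborel (safe M))"
    by (rule sets_restrict_space_cong) simp
  finally show sets: "sets (restrict_space (kern M x u) (safe M)) =
      sets (density (restrict_space lborel (safe M)) (\<lambda>y. ennreal (q y x u)))" by simp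
  fix B assume "B \<in> sets (restrict_space (kern M x u) (safe M))"
  then have "B \<in> sets (restrict_space lborel (safe M))" using sets by simp
  then have B: "B \<in> sets borel" "B \<subseteq> safe M"
    using safe_borel by (auto simp: sets_restrict_space_iff)
  have "emeasure (restrict_space (kern M x u) (safe M)) B = emeasure (kern M x u) B"
    using B safe_sets sets_kern[OF x u] sets.sets_into_space[OF safe_sets] space_kern[OF x u]
    by (intro emeasure_restrict_space) (auto simp: Int_absorb2)
  also have "\<dots> = (\<integral>\<^sup>+y\<in>B. ennreal (q y x u) \<partial>lborel)"
    using density x u B unfolding has_density_def by blast
  also have "\<dots> = (\<integral>\<^sup>+y. (ennreal (q y x u) * indicator B y) * indicator (safe M) y \<partial>lborel)"
    using B by (intro nn_integral_cong) (auto simp: indicator_def)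
  also have "\<dots> = (\<integral>\<^sup>+y. ennreal (q y x u) * indicator B y \<partial>restrict_space lborel (safe M))"
    using safe_borel by (subst nn_integral_restrict_space) auto
  also have "\<dots> = emeasure (density (restrict_space lborel (safe M)) (\<lambda>y. ennreal (q y x u))) B"
    using measurable_q[OF x u] \<open>B \<in> sets (restrict_space lborel (safe M))\<close> by (subst emeasure_density) auto
  finally show "emeasure (restrict_space (kern M x u) (safe M)) B =
      emeasure (density (restrict_space lborel (safe M)) (\<lambda>y. ennreal (q y x u))) B" .
qed

lemma nn_integral_kern_safe:
  assumes x: "x \<in> states M" and u: "u \<in> inputs M" and f: "f \<in> borel_measurable (state_space M)"
  shows "(\<integral>\<^sup>+y. f y * indicator (safe M) y \<partial>kern M x u) =
    (\<integral>\<^sup>+y. ennreal (q y x u) * f y \<partial>restrict_space lborel (safe M))"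
proof -
  have "(\<integral>\<^sup>+y. f y * indicator (safe M) y \<partial>kern M x u) = (\<integral>\<^sup>+y. f y \<partial>restrict_space (kern M x u) (safe M))"
    using safe_sets sets_kern[OF x u] sets.sets_into_space[OF safe_sets] space_kern[OF x u]
    by (subst nn_integral_restrict_space) (auto simp: Int_absorb2)
  also have "\<dots> = (\<integral>\<^sup>+y. ennreal (q y x u) * f y \<partial>restrict_space lborel (safe M))"
    unfolding restrict_kern_safe[OF x u]
    by (rule nn_integral_density[OF measurable_q[OF x u] measurable_on_safe[OF f]])
  finally show ?thesis .
qed

text \<open>The loss of one transition when the current state is replaced by its representative. Only this
  direction matters: it bounds what the gridded MDP promises by what the original one delivers.\<close>

lemma kern_representative_le:
  assumes x: "x \<in> safe M" and u: "u \<in> inputs M"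
    and f: "f \<in> borel_measurable (state_space M)" and f1: "\<And>y. y \<in> states M \<Longrightarrow> f y \<le> 1"
  shows "(\<integral>\<^sup>+y. f y * indicator (safe M) y \<partial>kern M (xi_x M G x) u) \<le>
    (\<integral>\<^sup>+y. f y * indicator (safe M) y \<partial>kern M x u) + ennreal step_error"
proof -
  let ?L = "restrict_space lborel (safe M)"
  let ?x = "xi_x M G x"
  have xs: "x \<in> states M" using x states_eq by blast
  have xs': "?x \<in> states M" by (rule xi_x_states[OF xs])
  have Mx: "Mx G \<noteq> 0" using representative_in_cells[OF partition_x x] by auto
  note nonneg = cell_bounds_nonneg[OF Mx]
  have spaceL: "space ?L = safe M" by (simp add: space_restrict_space)
  have emeasL: "emeasure ?L (safe M) = emeasure lborel (safe M)"
    using safe_borel by (subst emeasure_restrict_space) auto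
  have "(\<integral>\<^sup>+y. f y * indicator (safe M) y \<partial>kern M ?x u) = (\<integral>\<^sup>+y. ennreal (q y ?x u) * f y \<partial>?L)"
    by (rule nn_integral_kern_safe[OF xs' u f])
  also have "\<dots> \<le> (\<integral>\<^sup>+y. ennreal (q y x u) * f y + ennreal (hx * grid_size G) \<partial>?L)"
  proof (rule nn_integral_mono)
    fix y assume "y \<in> space ?L"
    then have y: "y \<in> states M" using spaceL states_eq by blast
    have "q y ?x u \<le> q y x u + hx * norm (x - ?x)" using lipschitz[OF y xs xs' u] by linarith
    also have "\<dots> \<le> q y x u + hx * grid_size G"
      using dist_xi_x_le[OF x] hx_nonneg by (simp add: mult_left_mono)
    finally have "ennreal (q y ?x u) \<le> ennreal (q y x u + hx * grid_size G)" by (rule ennreal_leI)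
    also have "\<dots> = ennreal (q y x u) + ennreal (hx * grid_size G)"
      using density y xs u hx_nonneg nonneg by (intro ennreal_plus) (auto simp: has_density_def)
    finally have "ennreal (q y ?x u) * f y \<le> (ennreal (q y x u) + ennreal (hx * grid_size G)) * f y"
      by (rule mult_right_mono) simp
    also have "\<dots> = ennreal (q y x u) * f y + ennreal (hx * grid_size G) * f y" by (rule distrib_right)
    also have "\<dots> \<le> ennreal (q y x u) * f y + ennreal (hx * grid_size G) * 1"
      using f1[OF y] by (intro add_left_mono mult_left_mono) auto
    finally show "ennreal (q y ?x u) * f y \<le> ennreal (q y x u) * f y + ennreal (hx * grid_size G)" by simp
  qed
  also have "\<dots> = (\<integral>\<^sup>+y. ennreal (q y x u) * f y \<partial>?L) + ennreal (hx * grid_size G) * emeasure lborel (safe M)"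
    using measurable_q[OF xs u] measurable_on_safe[OF f]
    by (subst nn_integral_add) (auto simp: emeasL spaceL)
  also have "\<dots> \<le> (\<integral>\<^sup>+y. ennreal (q y x u) * f y \<partial>?L) + ennreal step_error"
  proof (rule add_left_mono)
    have "ennreal (hx * grid_size G) * emeasure lborel (safe M)
        \<le> ennreal (hx * grid_size G) * ennreal (real (Mx G) * max_cell_measure G)"
      by (intro mult_left_mono emeasure_safe_le) simp
    also have "\<dots> = ennreal step_error"
      using hx_nonneg nonneg by (simp add: step_error_def ac_simps flip: ennreal_mult)
    finally show "ennreal (hx * grid_size G) * emeasure lborel (safe M) \<le> ennreal step_error" .
  qed
  also have "(\<integral>\<^sup>+y. ennreal (q y x u) * f y \<partial>?L) = (\<integral>\<^sup>+y. f y * indicator (safe M) y \<partial>kern M x u)"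
    by (rule nn_integral_kern_safe[OF xs u f, symmetric])
  finally show ?thesis .
qed

end


section \<open>Accumulation of the error along the horizon\<close>

locale adapted_policy = lipschitz_gridded_mdp M G q hx
  for M :: "('x::euclidean_space, 'u::polish_space) mdp" and G :: "('x, 'u) grid"
    and q :: "'x \<Rightarrow> 'x \<Rightarrow> 'u \<Rightarrow> real" and hx :: real +
  fixes \<rho> :: "nat \<Rightarrow> ('x \<times> real, 'u) hist \<Rightarrow> 'u measure" and x0 :: 'x
  assumes grid_policy: "\<rho> \<in> policies gstates ginputs (horizon M)"
    and x0: "x0 \<in> states M"
begin

abbreviation "hist_orig \<equiv> hist_space (state_space M) (input_space M)"
abbreviation "hist_grid \<equiv> hist_space gstates ginputs"

lemma adaptation_policy:
  "adaptation M G \<rho> \<in> policies (state_space M) (input_space M) (horizon M)"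
  unfolding policies_def
proof safe
  fix k assume k: "k < horizon M"
  have 1: "\<rho> k \<in> hist_grid k \<rightarrow>\<^sub>M prob_algebra ginputs" using grid_policy k by (simp add: policies_def)
  have 2: "(\<lambda>u. u) \<in> ginputs \<rightarrow>\<^sub>M input_space M"
    using grid_inputs_subset by (auto simp: measurable_count_space_eq1)
  have "(\<lambda>h. distr (\<rho> k (psi M G k h)) (input_space M) (\<lambda>u. u)) \<in> hist_orig k \<rightarrow>\<^sub>M prob_algebra (input_space M)"
    by (rule measurable_compose[OF measurable_compose[OF measurable_psi 1] measurable_distr_prob_space[OF 2]])
       (use k in simp)
  then show "adaptation M G \<rho> k \<in> hist_orig k \<rightarrow>\<^sub>M prob_algebra (input_space M)"
    by (simp add: adaptation_def[abs_def])
qed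

sublocale orig: controlled_process "state_space M" "input_space M" "\<lambda>k. kern M" "adaptation M G \<rho>" x0 "horizon M"
  using x0 adaptation_policy measurable_kern by unfold_locales auto

sublocale disc: controlled_process gstates ginputs "grid_kern M G" \<rho> "(xi_x M G x0, 0)" "horizon M"
proof
  show "(xi_x M G x0, 0) \<in> space gstates"
    using xi_x_in[OF x0] zero_in_creps unfolding grid_states_def by simp
qed (use grid_policy measurable_grid_kern in auto)

definition safe_hists :: "nat \<Rightarrow> ('x, 'u) hist set" where
  "safe_hists k = {h. \<forall>i\<le>k. fst h i \<in> safe M}"

lemma safe_hists_sets: "safe_hists k \<inter> space (hist_orig k) \<in> sets (hist_orig k)"
proof -
  have "{h \<in> space (hist_orig k). \<forall>i\<in>{..k}. fst h i \<in> safe M} \<in> sets (hist_orig k)"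
    using measurable_sets[OF measurable_state safe_sets]
    by (intro sets.sets_Collect_finite_All') (auto simp: vimage_def Int_def conj_commute)
  also have "{h \<in> space (hist_orig k). \<forall>i\<in>{..k}. fst h i \<in> safe M} = safe_hists k \<inter> space (hist_orig k)"
    by (auto simp: safe_hists_def)
  finally show ?thesis .
qed

lemma safe_hists_extend:
  "(indicator (safe_hists (Suc k)) (extend k h u y) :: ennreal) =
    indicator (safe_hists k) h * indicator (safe M) y"
  by (auto simp: safe_hists_def extend_def indicator_def le_Suc_eq)

lemma sets_grid_policy:
  assumes "k < horizon M" "h \<in> space (hist_grid k)"
  shows "sets (\<rho> k h) = Pow (grid_inputs G)" "space (\<rho> k h) = grid_inputs G" "prob_space (\<rho> k h)"
proof -
  show "sets (\<rho> k h) = Pow (grid_inputs G)" "prob_space (\<rho> k h)"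
    using disc.policy_in_prob_algebra[OF assms] by (auto simp: space_prob_algebra)
  then show "space (\<rho> k h) = grid_inputs G" using sets_eq_imp_space_eq[of "\<rho> k h" ginputs] by simp
qed

lemma measurable_grid_policy:
  fixes f :: "'u \<Rightarrow> ennreal"
  assumes "k < horizon M" "h \<in> space (hist_grid k)"
  shows "f \<in> borel_measurable (\<rho> k h)"
  using sets_grid_policy[OF assms] by (auto simp: measurable_def)

text \<open>The inductive heart of the proof. The gridded side only records safety of the current state, the
  original side safety of the whole path. The step replaces \<open>f\<close> by its average \<open>F\<close> over the next
  input and the next safe state; \<open>F\<close> is again a function of the gridded history bounded by \<open>1\<close>.\<close>

lemma value_comparison:
  assumes "k \<le> horizon M" "f \<in> borel_measurable (hist_grid k)"
    and "\<And>h. h \<in> space (hist_grid k) \<Longrightarrow> f h \<le> 1"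
  shows "(\<integral>\<^sup>+h. f h * indicator (safe M) (fst (fst h k)) \<partial>disc.law k) \<le>
    (\<integral>\<^sup>+h. f (psi M G k h) * indicator (safe_hists k) h \<partial>orig.law k) + of_nat k * ennreal step_error"
  using assms
proof (induction k arbitrary: f)
  case 0
  let ?h = "(\<lambda>i\<in>{..0}. x0, \<lambda>i\<in>{..<0}. undefined)"
  let ?g = "(\<lambda>i\<in>{..0}. (xi_x M G x0, 0), \<lambda>i\<in>{..<0}. undefined)"
  have psi0: "psi M G 0 ?h = ?g" by (auto simp: psi_def restrict_def)
  have m: "(\<lambda>h. f h * indicator (safe M) (fst (fst h 0))) \<in> borel_measurable (hist_grid 0)"
    by (intro borel_measurable_times_ennreal 0 measurable_compose[OF measurable_state[OF order_refl]]) simp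
  have m': "(\<lambda>h. f (psi M G 0 h) * indicator (safe_hists 0) h) \<in> borel_measurable (hist_orig 0)"
    using safe_hists_sets
    by (intro borel_measurable_times_ennreal measurable_compose[OF measurable_psi 0(2)])
       (auto simp: borel_measurable_indicator_iff)
  have "indicator (safe M) (xi_x M G x0) = (indicator (safe_hists 0) ?h :: ennreal)"
    using xi_x_safe_iff[OF x0] by (simp add: safe_hists_def indicator_def)
  then show ?case
    unfolding disc.nn_integral_law_0[OF m] orig.nn_integral_law_0[OF m'] psi0 by simp
next
  case (Suc k)
  have k: "k < horizon M" and k': "k \<le> horizon M" using Suc.prems by auto
  note fm = Suc.prems(2)
  let ?e = "ennreal step_error"
  let ?f = "\<lambda>h. f h * indicator (safe M) (fst (fst h (Suc k)))"
  let ?f' = "\<lambda>h. f (psi M G (Suc k) h) * indicator (safe_hists (Suc k)) h"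
  have m: "?f \<in> borel_measurable (hist_grid (Suc k))"
    by (intro borel_measurable_times_ennreal fm measurable_compose[OF measurable_state[OF order_refl]]) simp
  have m': "?f' \<in> borel_measurable (hist_orig (Suc k))"
    using safe_hists_sets[of "Suc k"]
    by (intro borel_measurable_times_ennreal measurable_compose[OF measurable_psi fm])
       (auto simp: borel_measurable_indicator_iff Suc.prems)
  define F where "F h = (\<integral>\<^sup>+u. \<integral>\<^sup>+s. ?f (extend k h u s) \<partial>grid_kern M G k (fst h k) u \<partial>\<rho> k h)" for h
  define W where "W h = (\<integral>\<^sup>+u. \<integral>\<^sup>+y. ?f' (extend k h u y) \<partial>kern M (fst h k) u \<partial>adaptation M G \<rho> k h)" for h
  have Fm: "F \<in> borel_measurable (hist_grid k)"
    unfolding F_def by (rule disc.measurable_step_integral[OF k m])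
  have Wm: "W \<in> borel_measurable (hist_orig k)"
    unfolding W_def by (rule orig.measurable_step_integral[OF k m'])
  have F_eq: "F h = (\<integral>\<^sup>+u. \<integral>\<^sup>+y. f (extend k h u (xi_x M G y, next_cost k (fst h k) u)) * indicator (safe M) y
      \<partial>kern M (fst (fst h k)) u \<partial>\<rho> k h)" if h: "h \<in> space (hist_grid k)" for h
    unfolding F_def
  proof (rule nn_integral_cong)
    fix u assume "u \<in> space (\<rho> k h)"
    then have u: "u \<in> inputs M" using sets_grid_policy[OF k h] grid_inputs_subset by auto
    have z: "fst h k \<in> grid_states M G" using space_hist_space_state[OF h] by simp
    show "(\<integral>\<^sup>+s. ?f (extend k h u s) \<partial>grid_kern M G k (fst h k) u) =
      (\<integral>\<^sup>+y. f (extend k h u (xi_x M G y, next_cost k (fst h k) u)) * indicator (safe M) y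
        \<partial>kern M (fst (fst h k)) u)"
      unfolding nn_integral_grid_kern[OF k z u]
      by (intro nn_integral_cong)
         (simp add: extend_def indicator_def space_kern[OF grid_statesD(1)[OF z] u] xi_x_safe_iff)
  qed
  have f1: "f (extend k h u (xi_x M G y, next_cost k (fst h k) u)) \<le> 1"
    if h: "h \<in> space (hist_grid k)" and u: "u \<in> grid_inputs G" and y: "y \<in> states M" for h u y
  proof (rule Suc.prems(3), rule extend_in_space[OF h])
    show "u \<in> space ginputs" using u by simp
    have "next_cost k (fst h k) u \<in> creps"
      using space_hist_space_state[OF h order_refl] u grid_inputs_subset by (intro next_cost_in[OF k]) auto
    then show "(xi_x M G y, next_cost k (fst h k) u) \<in> space gstates"
      using xi_x_in[OF y] unfolding grid_states_def by simp
  qed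
  have F1: "F h \<le> 1" if h: "h \<in> space (hist_grid k)" for h
  proof -
    interpret R: prob_space "\<rho> k h" by (rule sets_grid_policy(3)[OF k h])
    have x: "fst (fst h k) \<in> states M" using space_hist_space_state[OF h order_refl] grid_statesD(1) by simp
    have "F h \<le> (\<integral>\<^sup>+u. 1 \<partial>\<rho> k h)"
      unfolding F_eq[OF h]
    proof (rule nn_integral_mono)
      fix u assume "u \<in> space (\<rho> k h)"
      then have u: "u \<in> grid_inputs G" and u': "u \<in> inputs M"
        using sets_grid_policy[OF k h] grid_inputs_subset by auto
      interpret Q: prob_space "kern M (fst (fst h k)) u" by (rule prob_space_kern[OF x u'])
      have "(\<integral>\<^sup>+y. f (extend k h u (xi_x M G y, next_cost k (fst h k) u)) * indicator (safe M) y
          \<partial>kern M (fst (fst h k)) u) \<le> (\<integral>\<^sup>+y. 1 \<partial>kern M (fst (fst h k)) u)"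
        using f1[OF h u] by (intro nn_integral_mono) (auto simp: indicator_def space_kern[OF x u'])
      then show "(\<integral>\<^sup>+y. f (extend k h u (xi_x M G y, next_cost k (fst h k) u)) * indicator (safe M) y
          \<partial>kern M (fst (fst h k)) u) \<le> 1"
        by (simp add: Q.emeasure_space_1)
    qed
    then show ?thesis by (simp add: R.emeasure_space_1)
  qed
  \<comment> \<open>In an unsafe state \<open>F\<close> vanishes by absorption, so the safety indicator required by the
    induction hypothesis can be inserted for free.\<close>
  have F_safe: "F h * indicator (safe M) (fst (fst h k)) = F h" if h: "h \<in> space (hist_grid k)" for h
  proof (cases "fst (fst h k) \<in> safe M")
    case False
    then have x: "fst (fst h k) = xdag M"
      using space_hist_space_state[OF h order_refl] grid_statesD(1)[of "fst h k"] states_eq by auto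
    have "F h = (\<integral>\<^sup>+u. 0 \<partial>\<rho> k h)"
      unfolding F_eq[OF h] x
      using sets_grid_policy[OF k h] grid_inputs_subset
      by (intro nn_integral_cong kern_xdag_safe) auto
    then show ?thesis by simp
  qed simp
  \<comment> \<open>Along a safe path, one transition from the representative is exchanged for one from the true
    state; \<open>W\<close> is the average over that true transition under the adapted policy.\<close>
  have step: "F (psi M G k h) * indicator (safe_hists k) h \<le> W h + ?e" if h: "h \<in> space (hist_orig k)" for h
  proof (cases "h \<in> safe_hists k")
    case True
    let ?g = "psi M G k h" and ?x = "fst h k"
    have g: "?g \<in> space (hist_grid k)" by (rule measurable_space[OF measurable_psi[OF k'] h])
    have z: "fst ?g k \<in> grid_states M G" using space_hist_space_state[OF g order_refl] by simp
    have gx: "fst (fst ?g k) = xi_x M G ?x" by (simp add: psi_def)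
    have x: "?x \<in> safe M" using True by (simp add: safe_hists_def)
    then have xs: "?x \<in> states M" using states_eq by blast
    interpret R: prob_space "\<rho> k ?g" by (rule sets_grid_policy(3)[OF k g])
    let ?V = "\<lambda>u y. f (extend k ?g u (xi_x M G y, next_cost k (fst ?g k) u))"
    have "F ?g \<le> (\<integral>\<^sup>+u. (\<integral>\<^sup>+y. ?V u y * indicator (safe M) y \<partial>kern M ?x u) + ?e \<partial>\<rho> k ?g)"
      unfolding F_eq[OF g] gx
    proof (rule nn_integral_mono)
      fix u assume "u \<in> space (\<rho> k ?g)"
      then have u: "u \<in> grid_inputs G" and u': "u \<in> inputs M"
        using sets_grid_policy[OF k g] grid_inputs_subset by auto
      have e: "extend k ?g u \<in> gstates \<rightarrow>\<^sub>M hist_grid (Suc k)"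
        using measurable_compose[OF measurable_Pair1'[of "(?g, u)" "hist_grid k \<Otimes>\<^sub>M ginputs" gstates] measurable_extend] g u
        by (simp add: space_pair_measure)
      have Vm: "?V u \<in> borel_measurable (state_space M)"
        by (rule measurable_compose[OF measurable_compose[OF measurable_grid_state[OF next_cost_in[OF k z u']] e] fm])
      show "(\<integral>\<^sup>+y. ?V u y * indicator (safe M) y \<partial>kern M (xi_x M G ?x) u) \<le>
          (\<integral>\<^sup>+y. ?V u y * indicator (safe M) y \<partial>kern M ?x u) + ?e"
        by (rule kern_representative_le[OF x u' Vm f1[OF g u]])
    qed
    also have "\<dots> = (\<integral>\<^sup>+u. \<integral>\<^sup>+y. ?V u y * indicator (safe M) y \<partial>kern M ?x u \<partial>\<rho> k ?g) + ?e"
      by (subst nn_integral_add) (simp_all add: measurable_grid_policy[OF k g] R.emeasure_space_1)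
    also have "(\<integral>\<^sup>+u. \<integral>\<^sup>+y. ?V u y * indicator (safe M) y \<partial>kern M ?x u \<partial>\<rho> k ?g) =
        (\<integral>\<^sup>+u. \<integral>\<^sup>+y. ?f' (extend k h u y) \<partial>kern M ?x u \<partial>\<rho> k ?g)"
    proof (rule nn_integral_cong)
      fix u assume "u \<in> space (\<rho> k ?g)"
      then have u: "u \<in> grid_inputs G" using sets_grid_policy[OF k g] by auto
      show "(\<integral>\<^sup>+y. ?V u y * indicator (safe M) y \<partial>kern M ?x u) = (\<integral>\<^sup>+y. ?f' (extend k h u y) \<partial>kern M ?x u)"
        unfolding safe_hists_extend psi_extend[OF u] using True by simp
    qed
    also have "\<dots> = W h"
    proof -
      have id: "(\<lambda>u. u) \<in> \<rho> k ?g \<rightarrow>\<^sub>M input_space M"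
        using sets_grid_policy[OF k g] grid_inputs_subset by (auto simp: measurable_def)
      have "(\<lambda>u. \<integral>\<^sup>+y. ?f' (extend k h u y) \<partial>kern M ?x u) \<in> borel_measurable (input_space M)"
        using measurable_compose[OF measurable_Pair1'[OF h] orig.measurable_kernel_integral[OF k m']] by simp
      then show ?thesis
        unfolding W_def adaptation_def by (simp add: nn_integral_distr[OF id])
    qed
    finally show ?thesis using True by simp
  qed simp
  interpret O: prob_space "orig.law k" by (rule orig.prob_space_law[OF k'])
  have "(\<integral>\<^sup>+h. ?f h \<partial>disc.law (Suc k)) = (\<integral>\<^sup>+h. F h \<partial>disc.law k)"
    unfolding F_def by (rule disc.nn_integral_law_Suc[OF k m])
  also have "\<dots> = (\<integral>\<^sup>+h. F h * indicator (safe M) (fst (fst h k)) \<partial>disc.law k)"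
    by (intro nn_integral_cong F_safe[symmetric]) (simp add: disc.space_law[OF k'])
  also have "\<dots> \<le> (\<integral>\<^sup>+h. F (psi M G k h) * indicator (safe_hists k) h \<partial>orig.law k) + of_nat k * ?e"
    by (rule Suc.IH[OF k' Fm F1])
  also have "\<dots> \<le> (\<integral>\<^sup>+h. W h + ?e \<partial>orig.law k) + of_nat k * ?e"
    by (intro add_right_mono nn_integral_mono step) (simp add: orig.space_law[OF k'])
  also have "(\<integral>\<^sup>+h. W h + ?e \<partial>orig.law k) = (\<integral>\<^sup>+h. W h \<partial>orig.law k) + ?e"
    using Wm by (subst nn_integral_add) (simp_all add: orig.measurable_law[OF k'] O.emeasure_space_1)
  also have "(\<integral>\<^sup>+h. W h \<partial>orig.law k) = (\<integral>\<^sup>+h. ?f' h \<partial>orig.law (Suc k))"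
    unfolding W_def by (rule orig.nn_integral_law_Suc[OF k m', symmetric])
  finally show ?case
    by (simp only: of_nat_Suc distrib_right mult_1_left add.assoc)
qed

lemma safety_comparison:
  "(\<integral>\<^sup>+h. indicator (safe M) (fst (fst h (horizon M))) \<partial>disc.law (horizon M)) \<le>
    ennreal (measure (orig.law (horizon M)) {h \<in> space (orig.law (horizon M)). \<forall>k\<le>horizon M. fst h k \<in> safe M}
      + real (horizon M) * step_error)"
proof -
  let ?N = "horizon M"
  let ?L = "orig.law ?N"
  define E where "E = {h \<in> space ?L. \<forall>k\<le>?N. fst h k \<in> safe M}"
  have spaceL: "space ?L = space (hist_orig ?N)" by (rule orig.space_law[OF order_refl])
  have E_eq: "E = safe_hists ?N \<inter> space (hist_orig ?N)"
    unfolding E_def safe_hists_def spaceL by blast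
  have E: "E \<in> sets ?L"
    unfolding E_eq orig.sets_law[OF order_refl] by (rule safe_hists_sets)
  have "(\<integral>\<^sup>+h. 1 * indicator (safe M) (fst (fst h ?N)) \<partial>disc.law ?N) \<le>
      (\<integral>\<^sup>+h. 1 * indicator (safe_hists ?N) h \<partial>?L) + of_nat ?N * ennreal step_error"
    by (rule value_comparison[OF order_refl]) simp_all
  also have "(\<integral>\<^sup>+h. 1 * indicator (safe_hists ?N) h \<partial>?L) = (\<integral>\<^sup>+h. indicator E h \<partial>?L)"
  proof (rule nn_integral_cong)
    fix h assume "h \<in> space ?L"
    then show "1 * indicator (safe_hists ?N) h = (indicator E h :: ennreal)"
      unfolding E_eq spaceL indicator_def by (simp only: Int_iff mult_1_left simp_thms)
  qed
  also have "\<dots> = emeasure ?L E" by (rule nn_integral_indicator[OF E])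
  also have "\<dots> = ennreal (measure ?L E)"
    by (rule finite_measure.emeasure_eq_measure)
       (rule prob_space.finite_measure[OF orig.prob_space_law[OF order_refl]])
  also have "ennreal (measure ?L E) + of_nat ?N * ennreal step_error =
      ennreal (measure ?L E + real ?N * step_error)"
    unfolding ennreal_of_nat_eq_real_of_nat ennreal_mult[OF of_nat_0_le_iff step_error_nonneg, symmetric]
    by (rule ennreal_plus[symmetric]) (simp_all add: step_error_nonneg)
  finally show ?thesis unfolding E_def mult_1_left .
qed

text \<open>The last input is \<open>0\<close> or \<open>1\<close> and multiplies the safety indicator of the last state, so the
  constraint value is at most the probability of ending in the safe set.\<close>

lemma grid_value_le:
  assumes "\<rho>N \<in> hist_grid (horizon M) \<rightarrow>\<^sub>M prob_algebra (count_space {0, 1})"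
  shows "ennreal (\<integral>(h, u). gN M (fst h (horizon M)) u \<partial>grid_law M G \<rho> \<rho>N (xi_x M G x0, 0)) \<le>
    (\<integral>\<^sup>+h. indicator (safe M) (fst (fst h (horizon M))) \<partial>disc.law (horizon M))"
proof -
  let ?N = "horizon M" and ?B = "count_space {0, 1::nat}"
  let ?H = "hist_grid ?N \<Otimes>\<^sub>M ?B"
  let ?g = "\<lambda>p. gN M (fst (fst p) ?N) (snd p)"
  have "(\<lambda>p. (fst (fst p) ?N, snd p)) \<in> ?H \<rightarrow>\<^sub>M gstates \<Otimes>\<^sub>M ?B"
    by (intro measurable_Pair measurable_compose[OF measurable_fst measurable_state] measurable_snd) simp
  moreover have "gstates \<Otimes>\<^sub>M ?B = count_space (grid_states M G \<times> {0, 1})"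
    by (rule pair_measure_countable) (auto simp: grid_states_def)
  ultimately have "(\<lambda>p. (fst (fst p) ?N, snd p)) \<in> ?H \<rightarrow>\<^sub>M count_space (grid_states M G \<times> {0, 1})" by simp
  from measurable_compose[OF this, of "\<lambda>(z, u). ennreal (gN M z u)" borel]
  have gm: "(\<lambda>p. ennreal (?g p)) \<in> borel_measurable ?H" by simp
  have rm: "(\<lambda>(h, u). return ?H (h, u)) \<in> hist_grid ?N \<Otimes>\<^sub>M ?B \<rightarrow>\<^sub>M prob_algebra ?H"
    using measurable_return_prob_space[of ?H] by simp
  have bm: "(\<lambda>h. \<rho>N h \<bind> (\<lambda>u. return ?H (h, u))) \<in> hist_grid ?N \<rightarrow>\<^sub>M prob_algebra ?H"
    by (rule measurable_bind_prob_space2[OF assms rm])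
  have "ennreal (\<integral>p. ?g p \<partial>grid_law M G \<rho> \<rho>N (xi_x M G x0, 0)) \<le>
      (\<integral>\<^sup>+p. ennreal (?g p) \<partial>grid_law M G \<rho> \<rho>N (xi_x M G x0, 0))"
  \<comment> \<open>A function that is not integrable has integral \<open>0\<close>.\<close>
  proof (cases "integrable (grid_law M G \<rho> \<rho>N (xi_x M G x0, 0)) ?g")
    case True
    then show ?thesis
      by (subst nn_integral_eq_integral) (auto simp: gN_def)
  next
    case False
    then show ?thesis by (simp add: not_integrable_integral_eq)
  qed
  also have "\<dots> = (\<integral>\<^sup>+h. \<integral>\<^sup>+p. ennreal (?g p) \<partial>(\<rho>N h \<bind> (\<lambda>u. return ?H (h, u))) \<partial>disc.law ?N)"
    unfolding grid_law_def Let_def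
    using measurable_prob_algebraD[OF bm]
    by (intro nn_integral_bind[OF gm]) (simp add: disc.measurable_law)
  also have "\<dots> \<le> (\<integral>\<^sup>+h. indicator (safe M) (fst (fst h ?N)) \<partial>disc.law ?N)"
  proof (rule nn_integral_mono)
    fix h assume "h \<in> space (disc.law ?N)"
    then have h: "h \<in> space (hist_grid ?N)" by (simp add: disc.space_law)
    have "\<rho>N h \<in> space (prob_algebra ?B)" by (rule measurable_space[OF assms h])
    then have R: "prob_space (\<rho>N h)" "sets (\<rho>N h) = sets ?B" by (auto simp: space_prob_algebra)
    interpret R: prob_space "\<rho>N h" by (rule R(1))
    have spaceR: "space (\<rho>N h) = {0, 1}" using sets_eq_imp_space_eq[OF R(2)] by simp
    have "(\<lambda>u. return ?H (h, u)) \<in> ?B \<rightarrow>\<^sub>M subprob_algebra ?H"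
      by (rule measurable_compose[OF measurable_Pair1'[OF h] return_measurable])
    then have "(\<lambda>u. return ?H (h, u)) \<in> \<rho>N h \<rightarrow>\<^sub>M subprob_algebra ?H"
      using measurable_cong_sets[OF R(2) refl] by blast
    from nn_integral_bind[OF gm this]
    have "(\<integral>\<^sup>+p. ennreal (?g p) \<partial>(\<rho>N h \<bind> (\<lambda>u. return ?H (h, u)))) =
        (\<integral>\<^sup>+u. \<integral>\<^sup>+p. ennreal (?g p) \<partial>return ?H (h, u) \<partial>\<rho>N h)" .
    also have "\<dots> \<le> (\<integral>\<^sup>+u. indicator (safe M) (fst (fst h ?N)) \<partial>\<rho>N h)"
    proof (rule nn_integral_mono)
      fix u assume u: "u \<in> space (\<rho>N h)"
      then have "(h, u) \<in> space ?H" using h spaceR by (simp add: space_pair_measure)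
      then show "(\<integral>\<^sup>+p. ennreal (?g p) \<partial>return ?H (h, u)) \<le> indicator (safe M) (fst (fst h ?N))"
        using u unfolding spaceR
        by (subst nn_integral_return[OF _ gm]) (auto simp: gN_def indicator_def)
    qed
    also have "\<dots> = indicator (safe M) (fst (fst h ?N))" by (simp add: R.emeasure_space_1)
    finally show "(\<integral>\<^sup>+p. ennreal (?g p) \<partial>(\<rho>N h \<bind> (\<lambda>u. return ?H (h, u)))) \<le>
        indicator (safe M) (fst (fst h ?N))" .
  qed
  finally show ?thesis by (simp add: case_prod_beta')
qed

end

theorem mainTheorem2:
  fixes M :: "(real ^ 'n, 'u::polish_space) mdp"
    and G :: "(real ^ 'n, 'u) grid"
    and q :: "real ^ 'n \<Rightarrow> real ^ 'n \<Rightarrow> 'u \<Rightarrow> real"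
    and \<rho> :: "nat \<Rightarrow> ((real ^ 'n) \<times> real, 'u) hist \<Rightarrow> 'u measure"
    and \<rho>N :: "((real ^ 'n) \<times> real, 'u) hist \<Rightarrow> nat measure"
    and x0 :: "real ^ 'n"
    and \<alpha> hx :: real
  assumes "is_mdp M" and "x0 \<in> states M"
    and "P_feasible M x0 \<alpha>"
    and "compact (inputs M)" and "closed (safe M)"
    and "\<And>k. k < horizon M \<Longrightarrow>
           continuous_on (states M \<times> inputs M) (\<lambda>(x, u). stage_cost M k x u)"
    and "continuous_on (states M) (term_cost M)"
    and "weakly_continuous M"
    and "compact (states M)"
    and "has_density M q"
    and "hx > 0"
    and "\<And>y x x' u. y \<in> states M \<Longrightarrow> x \<in> states M \<Longrightarrow> x' \<in> states M \<Longrightarrow> u \<in> inputs M \<Longrightarrow>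
           \<bar>q y x u - q y x' u\<bar> \<le> hx * norm (x - x')"
    and "is_grid M G"
    and "Prz_feasible M G x0 \<alpha> \<rho> \<rho>N"
  shows "measure (mdp_law M (adaptation M G \<rho>) x0)
           {h \<in> space (mdp_law M (adaptation M G \<rho>) x0). \<forall>k\<le>horizon M. fst h k \<in> safe M}
         \<ge> \<alpha> - real (horizon M) * hx * real (Mx G) * max_cell_measure G * grid_size G"
proof -
  have "gridded_mdp M G" by (rule gridded_mdp.intro) (rule assms)+
  moreover have "lipschitz_gridded_mdp_axioms M q hx"
    using compact_imp_bounded[OF \<open>compact (states M)\<close>] \<open>has_density M q\<close> less_imp_le[OF \<open>hx > 0\<close>] assms(12)
    by (rule lipschitz_gridded_mdp_axioms.intro)
  moreover have "adapted_policy_axioms M G \<rho> x0"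
    using \<open>Prz_feasible M G x0 \<alpha> \<rho> \<rho>N\<close> \<open>x0 \<in> states M\<close>
    unfolding Prz_feasible_def is_grid_policy_def by (blast intro: adapted_policy_axioms.intro)
  ultimately interpret adapted_policy M G q hx \<rho> x0
    by (simp add: adapted_policy.intro lipschitz_gridded_mdp.intro)
  let ?N = "horizon M"
  let ?P = "measure (mdp_law M (adaptation M G \<rho>) x0)
    {h \<in> space (mdp_law M (adaptation M G \<rho>) x0). \<forall>k\<le>?N. fst h k \<in> safe M}"
  have \<rho>N: "\<rho>N \<in> hist_grid ?N \<rightarrow>\<^sub>M prob_algebra (count_space {0, 1})"
    and \<alpha>: "\<alpha> \<le> (\<integral>(h, u). gN M (fst h ?N) u \<partial>grid_law M G \<rho> \<rho>N (xi_x M G x0, 0))"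
    using \<open>Prz_feasible M G x0 \<alpha> \<rho> \<rho>N\<close> unfolding Prz_feasible_def is_grid_policy_def by blast+
  have "ennreal \<alpha> \<le> ennreal (?P + real ?N * step_error)"
    unfolding mdp_law_def
    using ennreal_leI[OF \<alpha>] grid_value_le[OF \<rho>N] safety_comparison by (rule order_trans[OF _ order_trans])
  then have "\<alpha> \<le> ?P + real ?N * step_error"
    using step_error_nonneg by (simp only: ennreal_le_iff add_nonneg_nonneg measure_nonneg mult_nonneg_nonneg of_nat_0_le_iff)
  moreover have "real ?N * step_error = real ?N * hx * real (Mx G) * max_cell_measure G * grid_size G"
    unfolding step_error_def by (simp only: mult.assoc)
  ultimately show ?thesis by linarith
qed

end
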